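(* Let $R$ be a ring with unit. Suppose that $C$ is a bounded above cochain complex of projective right $R[z,z^{-1}]$-modules. Suppose further that $C$ is homotopy equivalent, as a complex of $R$-modules, to a bounded complex $B$ of finitely generated projective right $R$-modules. Then $C$ has trivial positive and negative Novikov cohomology, that is, the two cochain complexes $C \otimes_{R[z,z^{-1}]} R((z))$ and $C \otimes_{R[z,z^{-1}]} R((z^{-1}))$ are acyclic.
   Context: $R$ is a ring with unit (not assumed commutative), and $R[z,z^{-1}]$ is the Laurent polynomial ring in an indeterminate $z$ that commutes with the elements of $R$. The Novikov rings are the rings of formal Laurent series $$R((z)) = R[[z]][z^{-1}] = \Big\{ \sum_{i \geq k} r_i z^i \,\Big|\, k \in \mathbb{Z},\ r_i \in R \Big\}, \qquad R((z^{-1})) = R[[z^{-1}]][z] = \Big\{ \sum_{i \leq k} r_i z^i \,\Big|\, k \in \mathbb{Z},\ r_i \in R \Big\},$$ with the usual multiplication of formal Laurent series; both contain $R[z,z^{-1}]$ as a subring. For a cochain complex $C$ of (right) $R[z,z^{-1}]$-modules, the positive Novikov cohomology of $C$ is the cohomology of the cochain complex $C \otimes_{R[z,z^{-1}]} R((z))$, and the negative Novikov cohomology of $C$ is the cohomology of the cochain complex $C \otimes_{R[z,z^{-1}]} R((z^{-1}))$. *)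

theory Defs
  imports "HOL-Algebra.Free_Abelian_Groups" "HOL-Algebra.Module"
begin

section \<open>Laurent polynomials and formal Laurent series\<close>

text \<open>
  A formal series \<open>\<Sum>\<^sub>i r\<^sub>i z\<^sup>i\<close> is the coefficient function \<open>i \<mapsto> r\<^sub>i\<close> on the integers.  The product is the
  Cauchy product, \<open>(f g)\<^sub>n = \<Sum>\<^sub>i f\<^sub>i g\<^sub>n\<^sub>-\<^sub>i\<close>, taken over the indices for which neither factor vanishes;
  for each of the three carriers below there are only finitely many such indices.
  The three rings share their operations, so \<open>R[z,z\<^sup>-\<^sup>1]\<close> is literally a subring of both Novikov
  rings.  Note that \<open>R\<close> may be non-commutative, and may be the zero ring.
\<close>

definition series_ring :: "('a, 'e) ring_scheme \<Rightarrow> (int \<Rightarrow> 'a) set \<Rightarrow> (int \<Rightarrow> 'a) ring"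
  where "series_ring R S =
    \<lparr>carrier = S,
     monoid.mult = (\<lambda>f g n. \<Oplus>\<^bsub>R\<^esub>i\<in>{i. f i \<noteq> \<zero>\<^bsub>R\<^esub> \<and> g (n - i) \<noteq> \<zero>\<^bsub>R\<^esub>}. f i \<otimes>\<^bsub>R\<^esub> g (n - i)),
     one = (\<lambda>n. if n = 0 then \<one>\<^bsub>R\<^esub> else \<zero>\<^bsub>R\<^esub>),
     zero = (\<lambda>n. \<zero>\<^bsub>R\<^esub>),
     add = (\<lambda>f g n. f n \<oplus>\<^bsub>R\<^esub> g n)\<rparr>"

definition laurent_poly :: "('a, 'e) ring_scheme \<Rightarrow> (int \<Rightarrow> 'a) ring"
  where "laurent_poly R = series_ring R {f \<in> UNIV \<rightarrow> carrier R. finite {i. f i \<noteq> \<zero>\<^bsub>R\<^esub>}}"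

text \<open>The Novikov rings \<open>R((z))\<close> and \<open>R((z\<^sup>-\<^sup>1))\<close>.\<close>

definition positive_novikov :: "('a, 'e) ring_scheme \<Rightarrow> (int \<Rightarrow> 'a) ring"
  where "positive_novikov R = series_ring R {f \<in> UNIV \<rightarrow> carrier R. \<exists>k. \<forall>i<k. f i = \<zero>\<^bsub>R\<^esub>}"

definition negative_novikov :: "('a, 'e) ring_scheme \<Rightarrow> (int \<Rightarrow> 'a) ring"
  where "negative_novikov R = series_ring R {f \<in> UNIV \<rightarrow> carrier R. \<exists>k. \<forall>i>k. f i = \<zero>\<^bsub>R\<^esub>}"

definition laurent_const :: "('a, 'e) ring_scheme \<Rightarrow> 'a \<Rightarrow> int \<Rightarrow> 'a"
  where "laurent_const R r = (\<lambda>n. if n = 0 then r else \<zero>\<^bsub>R\<^esub>)"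


section \<open>Right modules over a non-commutative ring\<close>

text \<open>
  As for \<open>module\<close> in \<open>HOL-Algebra\<close>, the record extends \<open>ring\<close> only to provide the additive structure;
  the fields \<open>mult\<close> and \<open>one\<close> of a module are never used.
\<close>

record ('a, 'b) right_module = "'b ring" +
  rsmult :: "'b \<Rightarrow> 'a \<Rightarrow> 'b" (infixl \<open>\<triangleleft>\<index>\<close> 70)

locale right_module = A?: ring A + M?: abelian_group M
  for A :: "('a, 'e) ring_scheme" (structure) and M :: "('a, 'b, 'f) right_module_scheme" (structure) +
  assumes rsmult_closed: "\<lbrakk>x \<in> carrier M; a \<in> carrier A\<rbrakk> \<Longrightarrow> x \<triangleleft>\<^bsub>M\<^esub> a \<in> carrier M"
    and rsmult_add_left: "\<lbrakk>x \<in> carrier M; y \<in> carrier M; a \<in> carrier A\<rbrakk>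
          \<Longrightarrow> (x \<oplus>\<^bsub>M\<^esub> y) \<triangleleft>\<^bsub>M\<^esub> a = x \<triangleleft>\<^bsub>M\<^esub> a \<oplus>\<^bsub>M\<^esub> y \<triangleleft>\<^bsub>M\<^esub> a"
    and rsmult_add_right: "\<lbrakk>x \<in> carrier M; a \<in> carrier A; b \<in> carrier A\<rbrakk>
          \<Longrightarrow> x \<triangleleft>\<^bsub>M\<^esub> (a \<oplus>\<^bsub>A\<^esub> b) = x \<triangleleft>\<^bsub>M\<^esub> a \<oplus>\<^bsub>M\<^esub> x \<triangleleft>\<^bsub>M\<^esub> b"
    and rsmult_assoc: "\<lbrakk>x \<in> carrier M; a \<in> carrier A; b \<in> carrier A\<rbrakk>
          \<Longrightarrow> x \<triangleleft>\<^bsub>M\<^esub> (a \<otimes>\<^bsub>A\<^esub> b) = (x \<triangleleft>\<^bsub>M\<^esub> a) \<triangleleft>\<^bsub>M\<^esub> b"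
    and rsmult_one: "x \<in> carrier M \<Longrightarrow> x \<triangleleft>\<^bsub>M\<^esub> \<one>\<^bsub>A\<^esub> = x"

definition right_module_hom ::
    "('a, 'e) ring_scheme \<Rightarrow> ('a, 'b, 'f) right_module_scheme \<Rightarrow> ('a, 'c, 'g) right_module_scheme
      \<Rightarrow> ('b \<Rightarrow> 'c) set"
  where "right_module_hom A M N =
    {f \<in> carrier M \<rightarrow> carrier N.
       (\<forall>x\<in>carrier M. \<forall>y\<in>carrier M. f (x \<oplus>\<^bsub>M\<^esub> y) = f x \<oplus>\<^bsub>N\<^esub> f y) \<and>
       (\<forall>x\<in>carrier M. \<forall>a\<in>carrier A. f (x \<triangleleft>\<^bsub>M\<^esub> a) = f x \<triangleleft>\<^bsub>N\<^esub> a)}"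

definition finitely_generated_module ::
    "('a, 'e) ring_scheme \<Rightarrow> ('a, 'b, 'f) right_module_scheme \<Rightarrow> bool"
  where "finitely_generated_module A M \<longleftrightarrow>
    (\<exists>S. finite S \<and> S \<subseteq> carrier M \<and>
      (\<forall>x\<in>carrier M. \<exists>a\<in>S \<rightarrow> carrier A. x = (\<Oplus>\<^bsub>M\<^esub>s\<in>S. s \<triangleleft>\<^bsub>M\<^esub> a s)))"

definition free_right_module :: "('a, 'e) ring_scheme \<Rightarrow> 'i set \<Rightarrow> ('a, 'i \<Rightarrow> 'a) right_module"
  where "free_right_module A I =
    \<lparr>carrier = {v \<in> UNIV \<rightarrow> carrier A. finite {i. v i \<noteq> \<zero>\<^bsub>A\<^esub>} \<and> {i. v i \<noteq> \<zero>\<^bsub>A\<^esub>} \<subseteq> I},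
     monoid.mult = undefined,
     one = undefined,
     zero = (\<lambda>i. \<zero>\<^bsub>A\<^esub>),
     add = (\<lambda>v w i. v i \<oplus>\<^bsub>A\<^esub> w i),
     rsmult = (\<lambda>v a i. v i \<otimes>\<^bsub>A\<^esub> a)\<rparr>"

text \<open>
  A module is projective if it is a direct summand of a free module, i.e. if it is a retract of one.
  There is no loss in drawing the basis from the type of elements of \<open>P\<close>: a retract of any free
  module at all has the lifting property, so the canonical surjection onto \<open>P\<close> from the free module
  on \<open>carrier P\<close> splits.
\<close>

definition projective_module ::
    "('a, 'e) ring_scheme \<Rightarrow> ('a, 'b, 'f) right_module_scheme \<Rightarrow> bool"
  where "projective_module A P \<longleftrightarrow> right_module A P \<and>
    (\<exists>(I :: 'b set) s p. s \<in> right_module_hom A P (free_right_module A I) \<and>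
       p \<in> right_module_hom A (free_right_module A I) P \<and> (\<forall>x\<in>carrier P. p (s x) = x))"

definition restrict_scalars ::
    "('r \<Rightarrow> 'a) \<Rightarrow> ('a, 'b, 'f) right_module_scheme \<Rightarrow> ('r, 'b) right_module"
  where "restrict_scalars \<phi> M =
    \<lparr>carrier = carrier M, monoid.mult = monoid.mult M, one = one M, zero = zero M, add = add M,
     rsmult = (\<lambda>x r. x \<triangleleft>\<^bsub>M\<^esub> \<phi> r)\<rparr>"


section \<open>Cochain complexes\<close>

text \<open>
  The objects of a complex are indexed by all integers, and \<open>diff C n\<close> maps degree \<open>n\<close> to degree
  \<open>n + 1\<close>.  Letting all objects have elements in a single type is no restriction, as the carriers may
  vary freely inside it (e.g. as the summands of a disjoint union).
\<close>

record ('m, 'b) cochain =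
  obj :: "int \<Rightarrow> 'm"
  diff :: "int \<Rightarrow> 'b \<Rightarrow> 'b"

type_synonym ('a, 'b) module_cochain = "(('a, 'b) right_module, 'b) cochain"

definition cochain_complex :: "('a, 'e) ring_scheme \<Rightarrow> ('a, 'b) module_cochain \<Rightarrow> bool"
  where "cochain_complex A C \<longleftrightarrow>
    (\<forall>n. right_module A (obj C n)) \<and>
    (\<forall>n. diff C n \<in> right_module_hom A (obj C n) (obj C (n + 1))) \<and>
    (\<forall>n. \<forall>x\<in>carrier (obj C n). diff C (n + 1) (diff C n x) = \<zero>\<^bsub>obj C (n + 1 + 1)\<^esub>)"

definition bounded_above_complex :: "('a, 'b) module_cochain \<Rightarrow> bool"
  where "bounded_above_complex C \<longleftrightarrow> (\<exists>N. \<forall>n>N. carrier (obj C n) = {\<zero>\<^bsub>obj C n\<^esub>})"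

definition bounded_below_complex :: "('a, 'b) module_cochain \<Rightarrow> bool"
  where "bounded_below_complex C \<longleftrightarrow> (\<exists>N. \<forall>n<N. carrier (obj C n) = {\<zero>\<^bsub>obj C n\<^esub>})"

definition bounded_complex :: "('a, 'b) module_cochain \<Rightarrow> bool"
  where "bounded_complex C \<longleftrightarrow> bounded_above_complex C \<and> bounded_below_complex C"

definition cochain_map ::
    "('a, 'e) ring_scheme \<Rightarrow> ('a, 'b) module_cochain \<Rightarrow> ('a, 'c) module_cochain
      \<Rightarrow> (int \<Rightarrow> 'b \<Rightarrow> 'c) \<Rightarrow> bool"
  where "cochain_map A C D f \<longleftrightarrow>
    (\<forall>n. f n \<in> right_module_hom A (obj C n) (obj D n)) \<and>
    (\<forall>n. \<forall>x\<in>carrier (obj C n). f (n + 1) (diff C n x) = diff D n (f n x))"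

text \<open>\<open>f - g = d h + h d\<close>, where \<open>h n\<close> maps degree \<open>n\<close> to degree \<open>n - 1\<close>.\<close>

definition cochain_homotopic ::
    "('a, 'e) ring_scheme \<Rightarrow> ('a, 'b) module_cochain \<Rightarrow> ('a, 'c) module_cochain
      \<Rightarrow> (int \<Rightarrow> 'b \<Rightarrow> 'c) \<Rightarrow> (int \<Rightarrow> 'b \<Rightarrow> 'c) \<Rightarrow> bool"
  where "cochain_homotopic A C D f g \<longleftrightarrow>
    (\<exists>h. (\<forall>n. h n \<in> right_module_hom A (obj C n) (obj D (n - 1))) \<and>
      (\<forall>n. \<forall>x\<in>carrier (obj C n).
         f n x \<ominus>\<^bsub>obj D n\<^esub> g n x = diff D (n - 1) (h n x) \<oplus>\<^bsub>obj D n\<^esub> h (n + 1) (diff C n x)))"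

definition homotopy_equivalent ::
    "('a, 'e) ring_scheme \<Rightarrow> ('a, 'b) module_cochain \<Rightarrow> ('a, 'c) module_cochain \<Rightarrow> bool"
  where "homotopy_equivalent A C D \<longleftrightarrow>
    (\<exists>f g. cochain_map A C D f \<and> cochain_map A D C g \<and>
       cochain_homotopic A C C (\<lambda>n x. g n (f n x)) (\<lambda>n x. x) \<and>
       cochain_homotopic A D D (\<lambda>n y. f n (g n y)) (\<lambda>n y. y))"

definition restrict_scalars_complex ::
    "('r \<Rightarrow> 'a) \<Rightarrow> ('a, 'b) module_cochain \<Rightarrow> ('r, 'b) module_cochain"
  where "restrict_scalars_complex \<phi> C = \<lparr>obj = (\<lambda>n. restrict_scalars \<phi> (obj C n)), diff = diff C\<rparr>"


section \<open>Tensor products\<close>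

text \<open>
  The tensor product of a right \<open>A\<close>-module \<open>M\<close> and a left \<open>A\<close>-module \<open>N\<close> is the quotient of the free
  abelian group on \<open>M \<times> N\<close> by the biadditivity and balancing relations; \<open>m \<otimes> n\<close> is the coset of
  \<open>frag_of (m, n)\<close>.  It is written multiplicatively, as all groups in \<open>HOL-Algebra\<close>.
\<close>

definition tensor_relations ::
    "('a, 'e) ring_scheme \<Rightarrow> ('a, 'b, 'f) right_module_scheme \<Rightarrow> ('a, 'c, 'g) module_scheme
      \<Rightarrow> ('b \<times> 'c \<Rightarrow>\<^sub>0 int) set"
  where "tensor_relations A M N =
    {frag_of (x \<oplus>\<^bsub>M\<^esub> x', y) - frag_of (x, y) - frag_of (x', y) | x x' y.
       x \<in> carrier M \<and> x' \<in> carrier M \<and> y \<in> carrier N} \<union>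
    {frag_of (x, y \<oplus>\<^bsub>N\<^esub> y') - frag_of (x, y) - frag_of (x, y') | x y y'.
       x \<in> carrier M \<and> y \<in> carrier N \<and> y' \<in> carrier N} \<union>
    {frag_of (x \<triangleleft>\<^bsub>M\<^esub> a, y) - frag_of (x, a \<odot>\<^bsub>N\<^esub> y) | x a y.
       x \<in> carrier M \<and> a \<in> carrier A \<and> y \<in> carrier N}"

definition tensor_subgroup ::
    "('a, 'e) ring_scheme \<Rightarrow> ('a, 'b, 'f) right_module_scheme \<Rightarrow> ('a, 'c, 'g) module_scheme
      \<Rightarrow> ('b \<times> 'c \<Rightarrow>\<^sub>0 int) set"
  where "tensor_subgroup A M N =
    generate (free_Abelian_group (carrier M \<times> carrier N)) (tensor_relations A M N)"

definition tensor_product ::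
    "('a, 'e) ring_scheme \<Rightarrow> ('a, 'b, 'f) right_module_scheme \<Rightarrow> ('a, 'c, 'g) module_scheme
      \<Rightarrow> ('b \<times> 'c \<Rightarrow>\<^sub>0 int) set monoid"
  where "tensor_product A M N =
    free_Abelian_group (carrier M \<times> carrier N) Mod tensor_subgroup A M N"

text \<open>
  The map \<open>f \<otimes> id\<close> from \<open>M \<otimes> N\<close> to \<open>M' \<otimes> N\<close> induced by a homomorphism \<open>f\<close> from \<open>M\<close> to \<open>M'\<close>: extend
  \<open>(m, n) \<mapsto> (f m, n)\<close> linearly to the free abelian groups, and pass to cosets.
\<close>

definition tensor_map ::
    "('a, 'e) ring_scheme \<Rightarrow> ('a, 'b, 'f) right_module_scheme \<Rightarrow> ('a, 'c, 'g) module_scheme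
      \<Rightarrow> ('b \<Rightarrow> 'b) \<Rightarrow> ('b \<times> 'c \<Rightarrow>\<^sub>0 int) set \<Rightarrow> ('b \<times> 'c \<Rightarrow>\<^sub>0 int) set"
  where "tensor_map A M' N f X =
    the_elem ((\<lambda>u. tensor_subgroup A M' N #>\<^bsub>free_Abelian_group (carrier M' \<times> carrier N)\<^esub>
                     frag_extend (\<lambda>(m, n). frag_of (f m, n)) u) ` X)"

definition tensor_complex ::
    "('a, 'e) ring_scheme \<Rightarrow> ('a, 'b) module_cochain \<Rightarrow> ('a, 'c, 'g) module_scheme
      \<Rightarrow> (('b \<times> 'c \<Rightarrow>\<^sub>0 int) set monoid, ('b \<times> 'c \<Rightarrow>\<^sub>0 int) set) cochain"
  where "tensor_complex A C N =
    \<lparr>obj = (\<lambda>n. tensor_product A (obj C n) N),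
     diff = (\<lambda>n. tensor_map A (obj C (n + 1)) N (diff C n))\<rparr>"

text \<open>A ring, regarded as a left module over (any subring of) itself.\<close>

definition left_regular_module :: "('a, 'e) ring_scheme \<Rightarrow> ('a, 'a) module"
  where "left_regular_module S =
    \<lparr>carrier = carrier S, monoid.mult = monoid.mult S, one = one S, zero = zero S, add = add S,
     smult = monoid.mult S\<rparr>"


section \<open>Novikov cohomology\<close>

text \<open>
  The cohomology of a complex of abelian groups, written multiplicatively.  This is also
  the underlying group of the cohomology of a complex of modules.
\<close>

definition cohomology :: "('g monoid, 'g) cochain \<Rightarrow> int \<Rightarrow> 'g set monoid"
  where "cohomology K n =
    (obj K n)\<lparr>carrier := kernel (obj K n) (obj K (n + 1)) (diff K n)\<rparr>
      Mod (diff K (n - 1) ` carrier (obj K (n - 1)))"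

definition acyclic_complex :: "('g monoid, 'g) cochain \<Rightarrow> bool"
  where "acyclic_complex K \<longleftrightarrow> (\<forall>n. trivial_group (cohomology K n))"

definition positive_novikov_complex ::
    "('a, 'e) ring_scheme \<Rightarrow> (int \<Rightarrow> 'a, 'b) module_cochain
      \<Rightarrow> (('b \<times> (int \<Rightarrow> 'a) \<Rightarrow>\<^sub>0 int) set monoid, ('b \<times> (int \<Rightarrow> 'a) \<Rightarrow>\<^sub>0 int) set) cochain"
  where "positive_novikov_complex R C =
    tensor_complex (laurent_poly R) C (left_regular_module (positive_novikov R))"

definition negative_novikov_complex ::
    "('a, 'e) ring_scheme \<Rightarrow> (int \<Rightarrow> 'a, 'b) module_cochain
      \<Rightarrow> (('b \<times> (int \<Rightarrow> 'a) \<Rightarrow>\<^sub>0 int) set monoid, ('b \<times> (int \<Rightarrow> 'a) \<Rightarrow>\<^sub>0 int) set) cochain"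
  where "negative_novikov_complex R C =
    tensor_complex (laurent_poly R) C (left_regular_module (negative_novikov R))"

end

theory Submission
  imports Defs "HOL-Algebra.AbelCoset"
begin

text \<open>
  The proof is the algebraic mapping torus argument.  Let \<open>N\<close> be one of the two Novikov rings, and let
  \<open>t = z\<^sup>-\<^sup>1\<close> if \<open>N = R((z))\<close> and \<open>t = z\<close> if \<open>N = R((z\<^sup>-\<^sup>1))\<close>.  For a projective \<open>R[z,z\<^sup>-\<^sup>1]\<close>-module \<open>P\<close>
  there is a short exact sequence from \<open>P \<otimes>\<^sub>R N\<close> to itself by \<open>t \<otimes> 1 - 1 \<otimes> t\<close>, with cokernel the tensor
  product of \<open>P\<close> and \<open>N\<close> over \<open>R[z,z\<^sup>-\<^sup>1]\<close>.  So \<open>C \<otimes> N\<close> is acyclic once \<open>t \<otimes> 1 - 1 \<otimes> t\<close> is bijective on the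
  cohomology of \<open>C \<otimes>\<^sub>R N\<close>.  Given \<open>f : C \<rightarrow> B\<close> and \<open>g : B \<rightarrow> C\<close> with \<open>g f\<close> homotopic to the identity, this
  operator corresponds to \<open>\<omega> \<otimes> 1 - 1 \<otimes> t\<close> on \<open>B \<otimes>\<^sub>R N\<close>, where \<open>\<omega> = f t g\<close>.  Since \<open>B\<close> is finitely
  generated, \<open>B \<otimes>\<^sub>R N\<close> maps onto all one-sided bounded series with coefficients in \<open>B\<close>, and there
  \<open>\<omega> b\<^sub>j - b\<^sub>j\<^sub>+\<^sub>1 = e\<^sub>j\<close> is a recursion with a unique solution.

  Over \<open>R\<close> the tensor product \<open>M \<otimes>\<^sub>R N\<close> is replaced throughout by its image in the series with
  coefficients in \<open>M\<close>; on these, \<open>R\<close>-linear maps act coefficientwise and \<open>1 \<otimes> t\<close> is a shift.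
\<close>

section \<open>Series with coefficients in a module\<close>

lemma right_module_homD:
  assumes "f \<in> right_module_hom A M N"
  shows "x \<in> carrier M \<Longrightarrow> f x \<in> carrier N"
    and "\<lbrakk>x \<in> carrier M; y \<in> carrier M\<rbrakk> \<Longrightarrow> f (x \<oplus>\<^bsub>M\<^esub> y) = f x \<oplus>\<^bsub>N\<^esub> f y"
    and "\<lbrakk>x \<in> carrier M; a \<in> carrier A\<rbrakk> \<Longrightarrow> f (x \<triangleleft>\<^bsub>M\<^esub> a) = f x \<triangleleft>\<^bsub>N\<^esub> a"
  using assms by (auto simp: right_module_hom_def)

lemma additive_abelian_group_homI:
  assumes "abelian_group G" "abelian_group H"
    and "\<And>x. x \<in> carrier G \<Longrightarrow> h x \<in> carrier H"
    and "\<And>x y. \<lbrakk>x \<in> carrier G; y \<in> carrier G\<rbrakk> \<Longrightarrow> h (x \<oplus>\<^bsub>G\<^esub> y) = h x \<oplus>\<^bsub>H\<^esub> h y"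
  shows "abelian_group_hom G H h"
  using assms
  by (intro abelian_group_homI group_hom.intro group_hom_axioms.intro)
    (auto simp: hom_def abelian_group.a_group)

lemma right_module_hom_abelian_group_hom:
  assumes "abelian_group M" "abelian_group N" "f \<in> right_module_hom A M N"
  shows "abelian_group_hom M N f"
  using assms by (intro additive_abelian_group_homI) (auto simp: right_module_hom_def)

lemma (in abelian_group_hom) hom_minus: 
  "\<lbrakk>x \<in> carrier G; y \<in> carrier G\<rbrakk> \<Longrightarrow> h (x \<ominus> y) = h x \<ominus>\<^bsub>H\<^esub> h y"
  by (simp add: a_minus_def)

lemma (in abelian_group_hom) hom_finsum:
  assumes "u \<in> I \<rightarrow> carrier G"
  shows "h (\<Oplus>i\<in>I. u i) = (\<Oplus>\<^bsub>H\<^esub>i\<in>I. h (u i))"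
  using assms
proof (induction I rule: infinite_finite_induct)
  case (insert i I)
  then show ?case
    by (simp add: Pi_iff G.finsum_insert H.finsum_insert)
qed auto

context right_module
begin

lemma rsmult_abelian_group_hom: "a \<in> carrier A \<Longrightarrow> abelian_group_hom M M (\<lambda>x. x \<triangleleft>\<^bsub>M\<^esub> a)"
  by (intro additive_abelian_group_homI)
    (auto simp: rsmult_closed rsmult_add_left M.abelian_group_axioms)

lemma scalar_abelian_group_hom: "x \<in> carrier M \<Longrightarrow> abelian_group_hom A M (\<lambda>a. x \<triangleleft>\<^bsub>M\<^esub> a)"
  by (intro additive_abelian_group_homI)
    (auto simp: rsmult_closed rsmult_add_right M.abelian_group_axioms A.is_abelian_group)

lemmas zero_rsmult = abelian_group_hom.hom_zero [OF rsmult_abelian_group_hom]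
  and rsmult_zero = abelian_group_hom.hom_zero [OF scalar_abelian_group_hom]
  and inv_rsmult = abelian_group_hom.hom_a_inv [OF rsmult_abelian_group_hom]

end

text \<open>The two Novikov rings are the cases \<open>\<epsilon> = 1\<close>, for \<open>R((z))\<close>, and \<open>\<epsilon> = -1\<close>, for \<open>R((z\<^sup>-\<^sup>1))\<close>.\<close>

definition novikov_series :: "int \<Rightarrow> ('a, 'e) ring_scheme \<Rightarrow> (int \<Rightarrow> 'a) set"
  where "novikov_series \<epsilon> R = {f \<in> UNIV \<rightarrow> carrier R. \<exists>k. \<forall>i. \<epsilon> * i < k \<longrightarrow> f i = \<zero>\<^bsub>R\<^esub>}"

text \<open>The image of \<open>M \<otimes>\<^sub>R N\<close> under \<open>x \<otimes> \<Sum>\<^sub>j a\<^sub>j z\<^sup>j \<mapsto> \<Sum>\<^sub>j (x a\<^sub>j) z\<^sup>j\<close>.\<close>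

inductive_set module_series ::
    "int \<Rightarrow> ('a, 'e) ring_scheme \<Rightarrow> ('a, 'b, 'f) right_module_scheme \<Rightarrow> (int \<Rightarrow> 'b) set"
  for \<epsilon> R M
  where
    gen: "\<lbrakk>x \<in> carrier M; a \<in> novikov_series \<epsilon> R\<rbrakk> \<Longrightarrow> (\<lambda>j. x \<triangleleft>\<^bsub>M\<^esub> a j) \<in> module_series \<epsilon> R M"
  | add: "\<lbrakk>c \<in> module_series \<epsilon> R M; c' \<in> module_series \<epsilon> R M\<rbrakk>
      \<Longrightarrow> (\<lambda>j. c j \<oplus>\<^bsub>M\<^esub> c' j) \<in> module_series \<epsilon> R M"

lemma novikov_series_closed: "a \<in> novikov_series \<epsilon> R \<Longrightarrow> a j \<in> carrier R"
  by (auto simp: novikov_series_def)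

lemma novikov_series_shift:
  assumes "a \<in> novikov_series \<epsilon> R"
  shows "(\<lambda>j. a (j + l)) \<in> novikov_series \<epsilon> R"
proof -
  obtain k where "\<forall>i. \<epsilon> * i < k \<longrightarrow> a i = \<zero>\<^bsub>R\<^esub>"
    using assms by (auto simp: novikov_series_def)
  then have "\<forall>i. \<epsilon> * i < k - \<epsilon> * l \<longrightarrow> a (i + l) = \<zero>\<^bsub>R\<^esub>"
    by (auto simp: algebra_simps)
  then show ?thesis
    using assms by (auto simp: novikov_series_def)
qed

lemma (in ring) zero_novikov_series: "(\<lambda>j. \<zero>) \<in> novikov_series \<epsilon> R"
  by (auto simp: novikov_series_def)

text \<open>A generator with coefficients \<open>x a_j\<close> is sent to the one with coefficients
  \<open>f(x) a_j\<close>. The induction carries membership of the coefficients in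
  \<open>carrier M\<close> along, because \<open>f\<close> is additive only there.\<close>

lemma module_series_hom:
  assumes f: "f \<in> right_module_hom R M N" and "right_module R M" and c: "c \<in> module_series \<epsilon> R M"
  shows "(\<lambda>j. f (c j)) \<in> module_series \<epsilon> R N"
proof -
  interpret M: right_module R M by fact
  have "(\<forall>j. c j \<in> carrier M) \<and> (\<lambda>j. f (c j)) \<in> module_series \<epsilon> R N"
    using c
  proof induction
    case (gen x a)
    with right_module_homD [OF f] show ?case
      by (auto simp: novikov_series_closed M.rsmult_closed intro: module_series.gen)
  next
    case (add c c')
    with right_module_homD [OF f] show ?case
      by (auto intro: module_series.add)
  qed
  then show ?thesis ..
qed

lemma module_series_shift:
  assumes "c \<in> module_series \<epsilon> R M"
  shows "(\<lambda>j. c (j + l)) \<in> module_series \<epsilon> R M"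
  using assms
proof induction
  case (gen x a)
  then show ?case
    using module_series.gen [OF _ novikov_series_shift] by fast
qed (rule module_series.add)

context right_module
begin

lemma module_series_closed: "c \<in> module_series \<epsilon> A M \<Longrightarrow> c j \<in> carrier M"
  by (induction arbitrary: j rule: module_series.induct) (auto simp: novikov_series_closed rsmult_closed)

text \<open>A finite sum of generators inherits a common bound from its Novikov factors. This bound
  is where the recursions over the coefficients start.\<close>

lemma module_series_bounded:
  assumes "c \<in> module_series \<epsilon> A M"
  shows "\<exists>k. \<forall>i. \<epsilon> * i < k \<longrightarrow> c i = \<zero>\<^bsub>M\<^esub>"
  using assms
proof induction
  case (gen x a)
  then show ?case
    by (auto simp: novikov_series_def rsmult_zero) (metis rsmult_zero)
next
  case (add c c')
  then obtain k k' where "\<forall>i. \<epsilon> * i < k \<longrightarrow> c i = \<zero>\<^bsub>M\<^esub>" "\<forall>i. \<epsilon> * i < k' \<longrightarrow> c' i = \<zero>\<^bsub>M\<^esub>"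
    by auto
  then show ?case
    by (intro exI [of _ "min k k'"]) auto
qed

lemma module_series_zero: "(\<lambda>j. \<zero>\<^bsub>M\<^esub>) \<in> module_series \<epsilon> A M"
  using module_series.gen [OF M.zero_closed A.zero_novikov_series, of \<epsilon>] by (simp add: zero_rsmult)

lemma module_series_inv:
  assumes "c \<in> module_series \<epsilon> A M"
  shows "(\<lambda>j. \<ominus>\<^bsub>M\<^esub> c j) \<in> module_series \<epsilon> A M"
  using assms
proof induction
  case (gen x a)
  then show ?case
    using module_series.gen [of "\<ominus>\<^bsub>M\<^esub> x" M a \<epsilon> A] by (simp add: inv_rsmult novikov_series_closed)
next
  case (add c c')
  then show ?case
    using module_series.add [OF add.IH] by (simp add: M.minus_add module_series_closed)
qed

lemma module_series_minus:
  "\<lbrakk>c \<in> module_series \<epsilon> A M; c' \<in> module_series \<epsilon> A M\<rbrakk>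
    \<Longrightarrow> (\<lambda>j. c j \<ominus>\<^bsub>M\<^esub> c' j) \<in> module_series \<epsilon> A M"
  unfolding a_minus_def by (intro module_series.add module_series_inv)

lemma module_series_finsum:
  assumes "finite I" "\<And>i. i \<in> I \<Longrightarrow> c i \<in> module_series \<epsilon> A M"
  shows "(\<lambda>j. \<Oplus>\<^bsub>M\<^esub>i\<in>I. c i j) \<in> module_series \<epsilon> A M"
  using assms
proof induction
  case (insert i I)
  have "(\<lambda>j. \<Oplus>\<^bsub>M\<^esub>i\<in>insert i I. c i j) = (\<lambda>j. c i j \<oplus>\<^bsub>M\<^esub> (\<Oplus>\<^bsub>M\<^esub>i\<in>I. c i j))"
    by (intro ext M.finsum_insert) (use insert in \<open>auto intro: module_series_closed\<close>)
  with insert show ?case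
    by (auto intro: module_series.add)
qed (simp add: module_series_zero)

text \<open>Finite generation turns a coefficientwise choice of coordinates into finitely many
  Novikov series, one per element of \<open>S\<close>, so \<open>c\<close> is a finite sum of
  generators of \<open>module_series\<close>.\<close>

lemma bounded_series_in_module_series:
  assumes fg: "finitely_generated_module A M"
    and c: "\<And>j. c j \<in> carrier M" and k: "\<And>i. \<epsilon> * i < k \<Longrightarrow> c i = \<zero>\<^bsub>M\<^esub>"
  shows "c \<in> module_series \<epsilon> A M"
proof -
  obtain S where S: "finite S" "S \<subseteq> carrier M"
    and gen: "\<forall>x\<in>carrier M. \<exists>a\<in>S \<rightarrow> carrier A. x = (\<Oplus>\<^bsub>M\<^esub>s\<in>S. s \<triangleleft>\<^bsub>M\<^esub> a s)"
    using fg by (auto simp: finitely_generated_module_def)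
  have "\<forall>j. \<exists>a\<in>S \<rightarrow> carrier A. c j = (\<Oplus>\<^bsub>M\<^esub>s\<in>S. s \<triangleleft>\<^bsub>M\<^esub> a s)"
    using gen c by auto
  then obtain a where a: "\<And>j. a j \<in> S \<rightarrow> carrier A" "\<And>j. c j = (\<Oplus>\<^bsub>M\<^esub>s\<in>S. s \<triangleleft>\<^bsub>M\<^esub> a j s)"
    by metis
  \<comment> \<open>The chosen coordinates of the zero element need not vanish, so they are cut off
    below \<open>k\<close> to give Novikov series.\<close>
  define b where "b s j = (if \<epsilon> * j < k then \<zero>\<^bsub>A\<^esub> else a j s)" for s j
  have "b s \<in> novikov_series \<epsilon> A" if "s \<in> S" for s
    using a(1) that by (auto simp: novikov_series_def b_def Pi_iff)
  moreover have c_eq: "c j = (\<Oplus>\<^bsub>M\<^esub>s\<in>S. s \<triangleleft>\<^bsub>M\<^esub> b s j)" for j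
  proof (cases "\<epsilon> * j < k")
    case True
    then have "(\<Oplus>\<^bsub>M\<^esub>s\<in>S. s \<triangleleft>\<^bsub>M\<^esub> b s j) = (\<Oplus>\<^bsub>M\<^esub>s\<in>S. \<zero>\<^bsub>M\<^esub>)"
      using S by (intro M.finsum_cong') (auto simp: b_def rsmult_zero)
    then show ?thesis
      using k [OF True] by (simp add: M.finsum_zero)
  qed (simp add: a(2) b_def)
  ultimately have "(\<lambda>j. \<Oplus>\<^bsub>M\<^esub>s\<in>S. s \<triangleleft>\<^bsub>M\<^esub> b s j) \<in> module_series \<epsilon> A M"
    using S by (intro module_series_finsum module_series.gen) auto
  then show ?thesis
    by (simp flip: c_eq)
qed

end

section \<open>First-order recursions for one-sided bounded series\<close>

lemma shift_recursion_unique: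
  fixes \<epsilon> :: int
  assumes \<epsilon>: "\<epsilon> = 1 \<or> \<epsilon> = -1" and k: "\<And>i. \<epsilon> * i < k \<Longrightarrow> c i = z"
    and step: "\<And>j. c (j + \<epsilon>) = \<omega> (c j)" and "\<omega> z = z"
  shows "c j = z"
proof -
  \<comment> \<open>The recursion moves one step in the direction \<open>\<epsilon>\<close>, so each
    induction step raises by one the bound below which \<open>c\<close> is known to equal
    \<open>z\<close>.\<close>
  have "\<forall>j. \<epsilon> * j < k + int n \<longrightarrow> c j = z" for n
  proof (induction n)
    case (Suc n)
    show ?case
    proof (intro allI impI)
      fix j assume "\<epsilon> * j < k + int (Suc n)"
      then have "\<epsilon> * (j - \<epsilon>) < k + int n"
        using \<epsilon> by auto
      with Suc have "c (j - \<epsilon>) = z" by blast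
      with step [of "j - \<epsilon>"] \<open>\<omega> z = z\<close> show "c j = z" by simp
    qed
  qed (simp add: k)
  from this [of "nat (\<epsilon> * j - k + 1)"] show ?thesis by auto
qed

text \<open>Read as \<open>c (j + \<epsilon>) = \<omega> (c j) - e j\<close>, the equation
  determines the coefficients one after the other, starting from zero at the bound
  \<open>k\<close>.\<close>

lemma shift_recursion_exists:
  fixes \<epsilon> :: int
  assumes "abelian_group_hom M M \<omega>" and \<epsilon>: "\<epsilon> = 1 \<or> \<epsilon> = -1"
    and e: "\<And>j. e j \<in> carrier M" and k: "\<And>i. \<epsilon> * i < k \<Longrightarrow> e i = \<zero>\<^bsub>M\<^esub>"
  obtains c where "\<And>j. c j \<in> carrier M" "\<And>i. \<epsilon> * i < k \<Longrightarrow> c i = \<zero>\<^bsub>M\<^esub>"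
    "\<And>j. \<omega> (c j) \<ominus>\<^bsub>M\<^esub> c (j + \<epsilon>) = e j"
proof -
  interpret \<omega>: abelian_group_hom M M \<omega> by fact
  \<comment> \<open>\<open>c' n\<close> is the coefficient at the index
    \<open>\<epsilon> * (k + int n)\<close>.\<close>
  define c' where "c' = rec_nat \<zero>\<^bsub>M\<^esub> (\<lambda>n x. \<omega> x \<ominus>\<^bsub>M\<^esub> e (\<epsilon> * (k + int n)))"
  have c'0: "c' 0 = \<zero>\<^bsub>M\<^esub>" and c'Suc: "c' (Suc n) = \<omega> (c' n) \<ominus>\<^bsub>M\<^esub> e (\<epsilon> * (k + int n))" for n
    by (simp_all add: c'_def)
  have c': "c' n \<in> carrier M" for n
    by (induction n) (auto simp: c'0 c'Suc e)
  \<comment> \<open>\<open>nat\<close> collapses every index with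
    \<open>\<epsilon> * j \<le> k\<close> to 0, so the series vanishes there, and below the bound
    the equation reads \<open>0 - 0 = 0\<close>.\<close>
  have *: "\<omega> (c' (nat (\<epsilon> * j - k))) \<ominus>\<^bsub>M\<^esub> c' (nat (\<epsilon> * (j + \<epsilon>) - k)) = e j" for j
  proof (cases "\<epsilon> * j < k")
    case True
    then have "nat (\<epsilon> * j - k) = 0" "nat (\<epsilon> * (j + \<epsilon>) - k) = 0" using \<epsilon> by auto
    then show ?thesis using True k by (simp add: c'0 a_minus_def)
  next
    case False
    then have "nat (\<epsilon> * (j + \<epsilon>) - k) = Suc (nat (\<epsilon> * j - k))"
      and "\<epsilon> * (k + int (nat (\<epsilon> * j - k))) = j" using \<epsilon> by auto
    then show ?thesis
      using c' e by (simp add: c'Suc a_minus_def \<omega>.G.minus_add \<omega>.G.r_neg \<omega>.G.r_neg1 \<omega>.G.r_neg2 flip: \<omega>.G.a_assoc)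
  qed
  show thesis
    by (rule that [of "\<lambda>j. c' (nat (\<epsilon> * j - k))"]) (auto simp: c' c'0 *)
qed

section \<open>The mapping torus\<close>

lemma (in abelian_group) minus_eq_iff:
  "\<lbrakk>x \<in> carrier G; y \<in> carrier G; z \<in> carrier G\<rbrakk> \<Longrightarrow> x \<ominus> y = z \<longleftrightarrow> x = z \<oplus> y"
  by (metis a_assoc a_comm a_inv_closed a_minus_def l_neg r_zero)

lemma (in abelian_group) minus_self: "x \<in> carrier G \<Longrightarrow> x \<ominus> x = \<zero>"
  by (simp add: minus_eq_iff)

lemma (in abelian_group) minus_eq_zero_iff:
  "\<lbrakk>x \<in> carrier G; y \<in> carrier G\<rbrakk> \<Longrightarrow> x \<ominus> y = \<zero> \<longleftrightarrow> x = y"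
  by (simp add: minus_eq_iff)

lemma (in abelian_group) add_minus_swap:
  "\<lbrakk>x \<in> carrier G; y \<in> carrier G; z \<in> carrier G\<rbrakk> \<Longrightarrow> (x \<oplus> y) \<ominus> z = (x \<ominus> z) \<oplus> y"
  by (simp add: a_minus_def a_ac)

lemma (in abelian_group) add_minus_cancel:
  "\<lbrakk>x \<in> carrier G; y \<in> carrier G\<rbrakk> \<Longrightarrow> (x \<oplus> y) \<ominus> y = x"
  by (simp add: minus_eq_iff)

lemma (in abelian_group) minus_minus_minus:
  "\<lbrakk>x \<in> carrier G; y \<in> carrier G; u \<in> carrier G; v \<in> carrier G\<rbrakk>
    \<Longrightarrow> (x \<ominus> y) \<ominus> (u \<ominus> v) = (x \<ominus> u) \<ominus> (y \<ominus> v)"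
  by (simp add: a_minus_def minus_add a_ac)

lemma (in abelian_group) minus_add_minus_cancel:
  "\<lbrakk>x \<in> carrier G; y \<in> carrier G; z \<in> carrier G\<rbrakk> \<Longrightarrow> (x \<ominus> y) \<oplus> (y \<ominus> z) = x \<ominus> z"
  by (simp add: a_minus_def a_assoc r_neg1)

text \<open>The final regrouping in \<open>mapping_torus_exact\<close>: there \<open>a - b\<close>
  and \<open>c - d\<close> are values of \<open>t\<close> minus the shift, to be merged into one
  value at a sum, while \<open>u\<close> and \<open>v\<close> are coboundaries, to be merged into
  one coboundary.\<close>

lemma (in abelian_group) minus_add_rearrange:
  "\<lbrakk>a \<in> carrier G; b \<in> carrier G; c \<in> carrier G; d \<in> carrier G; u \<in> carrier G; v \<in> carrier G\<rbrakk>
    \<Longrightarrow> (((a \<ominus> b) \<oplus> u) \<ominus> v) \<oplus> (c \<ominus> d) = (u \<ominus> v) \<oplus> ((c \<oplus> a) \<ominus> (d \<oplus> b))"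
  by (simp add: a_minus_def minus_add a_ac)

text \<open>Here \<open>C\<close> is a complex over \<open>R\<close> alone and \<open>t\<close> an
  \<open>R\<close>-linear chain endomorphism, later multiplication by
  \<open>z^(-\<epsilon>)\<close>. The data \<open>f\<close>, \<open>g\<close>, \<open>h\<close>
  present \<open>C\<close> as a retract of \<open>B\<close> up to homotopy.\<close>

locale complex_endomorphism =
  fixes R :: "('a, 'e) ring_scheme" and C :: "('a, 'b) module_cochain"
    and B :: "('a, 'c) module_cochain" and t f g h
  assumes complexes: "cochain_complex R C" "cochain_complex R B"
    and t: "cochain_map R C C t"
    and f: "cochain_map R C B f" and g: "cochain_map R B C g"
    and h: "\<And>n. h n \<in> right_module_hom R (obj C n) (obj C (n - 1))"
    and homotopy: "\<And>n x. x \<in> carrier (obj C n) \<Longrightarrow>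
      g n (f n x) \<ominus>\<^bsub>obj C n\<^esub> x = diff C (n - 1) (h n x) \<oplus>\<^bsub>obj C n\<^esub> h (n + 1) (diff C n x)"
    and fg: "\<And>n. finitely_generated_module R (obj B n)"
begin

lemma modules: "right_module R (obj C n)" "right_module R (obj B n)"
  using complexes by (auto simp: cochain_complex_def)

sublocale C: abelian_group "obj C n" for n
  using modules(1) by (rule right_module.axioms)

sublocale B: abelian_group "obj B n" for n
  using modules(2) by (rule right_module.axioms)

text \<open>The versions at \<open>n - 1\<close> name the codomain as degree \<open>n\<close> rather
  than \<open>n - 1 + 1\<close>, which is the form in which the homotopy formula meets them.\<close>

lemma homs:
  "t n \<in> right_module_hom R (obj C n) (obj C n)"
  "f n \<in> right_module_hom R (obj C n) (obj B n)"
  "g n \<in> right_module_hom R (obj B n) (obj C n)"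
  "diff C n \<in> right_module_hom R (obj C n) (obj C (n + 1))"
  "diff C (n - 1) \<in> right_module_hom R (obj C (n - 1)) (obj C n)"
  "diff B (n - 1) \<in> right_module_hom R (obj B (n - 1)) (obj B n)"
  "diff B n \<in> right_module_hom R (obj B n) (obj B (n + 1))"
  using t f g complexes unfolding cochain_map_def cochain_complex_def by (metis diff_add_cancel)+

sublocale t: abelian_group_hom "obj C n" "obj C n" "t n" for n
  by (rule right_module_hom_abelian_group_hom [OF C.abelian_group_axioms C.abelian_group_axioms homs(1)])
sublocale f: abelian_group_hom "obj C n" "obj B n" "f n" for n
  by (rule right_module_hom_abelian_group_hom [OF C.abelian_group_axioms B.abelian_group_axioms homs(2)])
sublocale g: abelian_group_hom "obj B n" "obj C n" "g n" for n
  by (rule right_module_hom_abelian_group_hom [OF B.abelian_group_axioms C.abelian_group_axioms homs(3)])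
sublocale dC: abelian_group_hom "obj C n" "obj C (n + 1)" "diff C n" for n
  by (rule right_module_hom_abelian_group_hom [OF C.abelian_group_axioms C.abelian_group_axioms homs(4)])
sublocale dC': abelian_group_hom "obj C (n - 1)" "obj C n" "diff C (n - 1)" for n
  by (rule right_module_hom_abelian_group_hom [OF C.abelian_group_axioms C.abelian_group_axioms homs(5)])
sublocale dB: abelian_group_hom "obj B n" "obj B (n + 1)" "diff B n" for n
  by (rule right_module_hom_abelian_group_hom [OF B.abelian_group_axioms B.abelian_group_axioms homs(7)])
sublocale dB': abelian_group_hom "obj B (n - 1)" "obj B n" "diff B (n - 1)" for n
  by (rule right_module_hom_abelian_group_hom [OF B.abelian_group_axioms B.abelian_group_axioms homs(6)])
sublocale h: abelian_group_hom "obj C n" "obj C (n - 1)" "h n" for n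
  by (rule right_module_hom_abelian_group_hom [OF C.abelian_group_axioms C.abelian_group_axioms h])

lemma commutes:
  "x \<in> carrier (obj C n) \<Longrightarrow> diff C n (t n x) = t (n + 1) (diff C n x)"
  "x \<in> carrier (obj C (n - 1)) \<Longrightarrow> diff C (n - 1) (t (n - 1) x) = t n (diff C (n - 1) x)"
  "x \<in> carrier (obj C (n - 1)) \<Longrightarrow> diff B (n - 1) (f (n - 1) x) = f n (diff C (n - 1) x)"
  "y \<in> carrier (obj B (n - 1)) \<Longrightarrow> diff C (n - 1) (g (n - 1) y) = g n (diff B (n - 1) y)"
  "x \<in> carrier (obj C n) \<Longrightarrow> diff B n (f n x) = f (n + 1) (diff C n x)"
  "y \<in> carrier (obj B n) \<Longrightarrow> diff C n (g n y) = g (n + 1) (diff B n y)"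
  using t f g unfolding cochain_map_def by (metis diff_add_cancel)+

lemma dC_dC: "x \<in> carrier (obj C (n - 1)) \<Longrightarrow> diff C n (diff C (n - 1) x) = \<zero>\<^bsub>obj C (n + 1)\<^esub>"
  using complexes(1) unfolding cochain_complex_def by (metis diff_add_cancel)

text \<open>On a cocycle the second term of the homotopy formula is \<open>h\<close> of zero, so
  only a coboundary separates \<open>g f\<close> from the identity.\<close>

lemma cocycle_homotopy:
  assumes "x \<in> carrier (obj C n)" "diff C n x = \<zero>\<^bsub>obj C (n + 1)\<^esub>"
  shows "g n (f n x) = x \<oplus>\<^bsub>obj C n\<^esub> diff C (n - 1) (h n x)"
proof -
  have "g n (f n x) \<ominus>\<^bsub>obj C n\<^esub> x = diff C (n - 1) (h n x)"
    using homotopy [OF assms(1)] assms h.hom_zero [of "n + 1"] by simp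
  then have "g n (f n x) = diff C (n - 1) (h n x) \<oplus>\<^bsub>obj C n\<^esub> x"
    using assms(1) by (simp add: C.minus_eq_iff)
  also have "\<dots> = x \<oplus>\<^bsub>obj C n\<^esub> diff C (n - 1) (h n x)"
    using assms(1) by (intro C.a_comm) simp_all
  finally show ?thesis .
qed

definition \<omega> :: "int \<Rightarrow> 'c \<Rightarrow> 'c" where "\<omega> n b = f n (t n (g n b))"

sublocale \<omega>: abelian_group_hom "obj B n" "obj B n" "\<omega> n" for n
  unfolding \<omega>_def
  by (intro additive_abelian_group_homI B.abelian_group_axioms) auto

lemma series_homs:
  "x \<in> module_series \<epsilon> R (obj C n) \<Longrightarrow> (\<lambda>j. t n (x j)) \<in> module_series \<epsilon> R (obj C n)"
  "x \<in> module_series \<epsilon> R (obj C n) \<Longrightarrow> (\<lambda>j. f n (x j)) \<in> module_series \<epsilon> R (obj B n)"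
  "y \<in> module_series \<epsilon> R (obj B n) \<Longrightarrow> (\<lambda>j. g n (y j)) \<in> module_series \<epsilon> R (obj C n)"
  "x \<in> module_series \<epsilon> R (obj C n) \<Longrightarrow> (\<lambda>j. diff C n (x j)) \<in> module_series \<epsilon> R (obj C (n + 1))"
  "x \<in> module_series \<epsilon> R (obj C (n - 1)) \<Longrightarrow> (\<lambda>j. diff C (n - 1) (x j)) \<in> module_series \<epsilon> R (obj C n)"
  "y \<in> module_series \<epsilon> R (obj B (n - 1)) \<Longrightarrow> (\<lambda>j. diff B (n - 1) (y j)) \<in> module_series \<epsilon> R (obj B n)"
  "x \<in> module_series \<epsilon> R (obj C n) \<Longrightarrow> (\<lambda>j. h n (x j)) \<in> module_series \<epsilon> R (obj C (n - 1))"
  "y \<in> module_series \<epsilon> R (obj B n) \<Longrightarrow> (\<lambda>j. diff B n (y j)) \<in> module_series \<epsilon> R (obj B (n + 1))"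
  subgoal by (rule module_series_hom [OF homs(1) modules(1)])
  subgoal by (rule module_series_hom [OF homs(2) modules(1)])
  subgoal by (rule module_series_hom [OF homs(3) modules(2)])
  subgoal by (rule module_series_hom [OF homs(4) modules(1)])
  subgoal by (rule module_series_hom [OF homs(5) modules(1)])
  subgoal by (rule module_series_hom [OF homs(6) modules(2)])
  subgoal by (rule module_series_hom [OF h modules(1)])
  subgoal by (rule module_series_hom [OF homs(7) modules(2)])
  done

lemmas series_minus = right_module.module_series_minus [OF modules(1)] right_module.module_series_minus [OF modules(2)]
lemmas series_closed = right_module.module_series_closed [OF modules(1)] right_module.module_series_closed [OF modules(2)]
lemmas series_bounded = right_module.module_series_bounded [OF modules(1)] right_module.module_series_bounded [OF modules(2)]

text \<open>Surjectivity of \<open>\<omega>\<close> minus the shift on series over \<open>B\<close>.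
  The recursion yields a one-sided bounded coefficient function, which finite generation places in
  \<open>module_series\<close>.\<close>

lemma solve_\<omega>:
  assumes "\<epsilon> = 1 \<or> \<epsilon> = -1" and e: "e \<in> module_series \<epsilon> R (obj B n)"
  obtains b where "b \<in> module_series \<epsilon> R (obj B n)"
    "\<And>j. \<omega> n (b j) \<ominus>\<^bsub>obj B n\<^esub> b (j + \<epsilon>) = e j"
proof -
  obtain k where k: "\<And>i. \<epsilon> * i < k \<Longrightarrow> e i = \<zero>\<^bsub>obj B n\<^esub>"
    using series_bounded(2) [OF e] by blast
  obtain b where b: "\<And>j. b j \<in> carrier (obj B n)" "\<And>i. \<epsilon> * i < k \<Longrightarrow> b i = \<zero>\<^bsub>obj B n\<^esub>"
    and b_eq: "\<And>j. \<omega> n (b j) \<ominus>\<^bsub>obj B n\<^esub> b (j + \<epsilon>) = e j"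
    by (rule shift_recursion_exists [OF \<omega>.abelian_group_hom_axioms assms(1), where e = e and k = k])
      (rule series_closed(2) [OF e], erule k, rule that)
  have "b \<in> module_series \<epsilon> R (obj B n)"
    using b by (rule right_module.bounded_series_in_module_series [OF modules(2) fg])
  then show thesis using b_eq by (rule that)
qed

text \<open>Injectivity of the same operator: an element of its kernel obeys
  \<open>z (j + \<epsilon>) = \<omega> n (z j)\<close> and starts with zeros.\<close>

lemma \<omega>_recursion_unique:
  assumes "\<epsilon> = 1 \<or> \<epsilon> = -1" and z: "z \<in> module_series \<epsilon> R (obj B n)"
    and eq: "\<And>j. \<omega> n (z j) \<ominus>\<^bsub>obj B n\<^esub> z (j + \<epsilon>) = \<zero>\<^bsub>obj B n\<^esub>"
  shows "z j = \<zero>\<^bsub>obj B n\<^esub>"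
proof -
  obtain k where k: "\<And>i. \<epsilon> * i < k \<Longrightarrow> z i = \<zero>\<^bsub>obj B n\<^esub>"
    using series_bounded(2) [OF z] by blast
  have step: "z (j + \<epsilon>) = \<omega> n (z j)" for j
    using eq [of j] series_closed(2) [OF z] by (simp add: B.minus_eq_zero_iff)
  show ?thesis
    by (rule shift_recursion_unique [OF assms(1), where c = z and \<omega> = "\<omega> n" and k = k])
      (erule k, rule step, rule \<omega>.hom_zero)
qed

text \<open>Write \<theta> for \<open>t\<close> minus the shift. This is injectivity of \<theta> on
  the cohomology of the series in \<open>C\<close>; that \<open>y\<close> is a cocycle follows from
  \<open>eq\<close>. The argument pushes \<open>y\<close> forward along \<open>f\<close>, uses
  bijectivity of the corresponding operator over \<open>B\<close>, and returns along
  \<open>g\<close>.\<close>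

lemma coboundary_of_cocycle:
  fixes \<epsilon> :: int
  assumes \<epsilon>: "\<epsilon> = 1 \<or> \<epsilon> = -1"
    and x: "x \<in> module_series \<epsilon> R (obj C (n - 1))" and y: "y \<in> module_series \<epsilon> R (obj C n)"
    and eq: "\<And>j. diff C (n - 1) (x j) = t n (y j) \<ominus>\<^bsub>obj C n\<^esub> y (j + \<epsilon>)"
  obtains w where "w \<in> module_series \<epsilon> R (obj C (n - 1))" "\<And>j. y j = diff C (n - 1) (w j)"
proof -
  note closed [simp] = series_closed(1) [OF x] series_closed(1) [OF y]
  \<comment> \<open>Applying the differential to \<open>eq\<close> shows that the differential of
    \<open>y\<close> satisfies the homogeneous recursion for \<open>t\<close>, so its one-sided
    bound alone forces it to vanish.\<close>
  have dy: "diff C n (y j) = \<zero>\<^bsub>obj C (n + 1)\<^esub>" for j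
  proof (rule shift_recursion_unique [OF \<epsilon>, where c = "\<lambda>j. diff C n (y j)"])
    \<comment> \<open>The \<open>SOME\<close> term names a bound for the series
      \<open>diff C n (y j)\<close> and so instantiates the parameter \<open>k\<close> of the
      rule.\<close>
    show "\<epsilon> * i < (SOME k. \<forall>i. \<epsilon> * i < k \<longrightarrow> diff C n (y i) = \<zero>\<^bsub>obj C (n + 1)\<^esub>)
      \<Longrightarrow> diff C n (y i) = \<zero>\<^bsub>obj C (n + 1)\<^esub>" for i
      using someI_ex [OF series_bounded(1) [OF series_homs(4) [OF y]]] by blast
    show "diff C n (y (j + \<epsilon>)) = t (n + 1) (diff C n (y j))" for j
    proof -
      have "t (n + 1) (diff C n (y j)) \<ominus>\<^bsub>obj C (n + 1)\<^esub> diff C n (y (j + \<epsilon>)) = \<zero>\<^bsub>obj C (n + 1)\<^esub>"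
        using arg_cong [OF eq [of j], of "diff C n"] by (simp add: dC.hom_minus dC_dC commutes)
      then show ?thesis
        by (simp add: C.minus_eq_zero_iff)
    qed
  qed (rule t.hom_zero)
  \<comment> \<open>Since \<open>\<omega> f y = f t (g f y) = f t y + d f t h y\<close>, the
    operator \<open>\<omega>\<close> minus the shift sends \<open>f y\<close> to the coboundary of
    this \<open>e\<close>.\<close>
  define e where "e j = f (n - 1) (x j) \<oplus>\<^bsub>obj B (n - 1)\<^esub> f (n - 1) (t (n - 1) (h n (y j)))" for j
  have e: "e \<in> module_series \<epsilon> R (obj B (n - 1))"
    unfolding e_def using x y by (intro module_series.add series_homs)
  obtain e' where e': "e' \<in> module_series \<epsilon> R (obj B (n - 1))"
    and e'_eq: "\<And>j. \<omega> (n - 1) (e' j) \<ominus>\<^bsub>obj B (n - 1)\<^esub> e' (j + \<epsilon>) = e j"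
    by (rule solve_\<omega> [OF \<epsilon> e]) (rule that)
  note [simp] = series_closed(2) [OF e'] series_closed(2) [OF e]
  \<comment> \<open>\<open>f y\<close> and the coboundary of \<open>e'\<close> have the same image
    under \<open>\<omega>\<close> minus the shift, so their difference lies in the kernel and
    vanishes.\<close>
  let ?z = "\<lambda>j. f n (y j) \<ominus>\<^bsub>obj B n\<^esub> diff B (n - 1) (e' j)"
  have z: "?z \<in> module_series \<epsilon> R (obj B n)"
    using y e' by (intro series_minus series_homs)
  have "?z j = \<zero>\<^bsub>obj B n\<^esub>" for j
  proof (rule \<omega>_recursion_unique [where z = ?z, OF \<epsilon> z])
    fix j
    have "\<omega> n (f n (y j)) \<ominus>\<^bsub>obj B n\<^esub> f n (y (j + \<epsilon>)) = diff B (n - 1) (e j)"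
      unfolding \<omega>_def e_def
      by (simp add: cocycle_homotopy dy commutes eq f.hom_minus B.add_minus_swap)
    moreover have "\<omega> n (diff B (n - 1) (e' j)) \<ominus>\<^bsub>obj B n\<^esub> diff B (n - 1) (e' (j + \<epsilon>)) = diff B (n - 1) (e j)"
      unfolding e'_eq [symmetric] by (simp add: \<omega>_def commutes dB'.hom_minus)
    ultimately show "\<omega> n (?z j) \<ominus>\<^bsub>obj B n\<^esub> ?z (j + \<epsilon>) = \<zero>\<^bsub>obj B n\<^esub>"
      by (simp add: \<omega>.hom_minus B.minus_minus_minus B.minus_self)
  qed
  then have fy: "f n (y j) = diff B (n - 1) (e' j)" for j
    by (simp add: B.minus_eq_zero_iff)
  show thesis
  proof (rule that)
    \<comment> \<open>The primitive comes from combining \<open>g f y = y + d h y\<close> with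
      \<open>f y = d e'\<close>.\<close>
    show "(\<lambda>j. g (n - 1) (e' j) \<ominus>\<^bsub>obj C (n - 1)\<^esub> h n (y j)) \<in> module_series \<epsilon> R (obj C (n - 1))"
      using y e' by (intro series_minus series_homs)
    show "y j = diff C (n - 1) (g (n - 1) (e' j) \<ominus>\<^bsub>obj C (n - 1)\<^esub> h n (y j))" for j
      using cocycle_homotopy [OF _ dy, of j]
      by (simp add: dC'.hom_minus commutes flip: fy) (simp add: C.add_minus_cancel)
  qed
qed

text \<open>With \<theta> for \<open>t\<close> minus the shift, this is exactness of the cokernel of
  \<theta>: an element whose differential lies in the image of \<theta> is a coboundary modulo that
  image. Injectivity of \<theta> on cohomology allows \<open>x\<close> to be corrected to a cocycle,
  and surjectivity over \<open>B\<close> writes that cocycle as a value of \<theta> plus a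
  coboundary.\<close>

proposition mapping_torus_exact:
  fixes \<epsilon> :: int
  assumes \<epsilon>: "\<epsilon> = 1 \<or> \<epsilon> = -1"
    and x: "x \<in> module_series \<epsilon> R (obj C n)" and y: "y \<in> module_series \<epsilon> R (obj C (n + 1))"
    and eq: "\<And>j. diff C n (x j) = t (n + 1) (y j) \<ominus>\<^bsub>obj C (n + 1)\<^esub> y (j + \<epsilon>)"
  obtains u v where "u \<in> module_series \<epsilon> R (obj C (n - 1))" "v \<in> module_series \<epsilon> R (obj C n)"
    "\<And>j. x j = diff C (n - 1) (u j) \<oplus>\<^bsub>obj C n\<^esub> (t n (v j) \<ominus>\<^bsub>obj C n\<^esub> v (j + \<epsilon>))"
proof -
  \<comment> \<open>The preceding lemma is used one degree up, and the unfolding turns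
    \<open>n + 1 - 1\<close> into \<open>n\<close>. As \<open>t\<close> and the shift commute with
    the differential, subtracting the value of \<theta> at \<open>w\<close> from \<open>x\<close>
    leaves a cocycle.\<close>
  obtain w where w: "w \<in> module_series \<epsilon> R (obj C n)" and yw: "\<And>j. y j = diff C n (w j)"
    using coboundary_of_cocycle [OF \<epsilon>, of x "n + 1" y] x y eq unfolding add_diff_cancel_right' by blast
  define x' where "x' j = x j \<ominus>\<^bsub>obj C n\<^esub> (t n (w j) \<ominus>\<^bsub>obj C n\<^esub> w (j + \<epsilon>))" for j
  have x': "x' \<in> module_series \<epsilon> R (obj C n)"
    unfolding x'_def using x w by (intro series_minus series_homs module_series_shift)
  note [simp] = series_closed(1) [OF x] series_closed(1) [OF w] series_closed(1) [OF x']
  have dx': "diff C n (x' j) = \<zero>\<^bsub>obj C (n + 1)\<^esub>" for j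
    by (simp add: x'_def dC.hom_minus eq yw commutes C.minus_self)
  obtain b where b: "b \<in> module_series \<epsilon> R (obj B n)"
    and b_eq: "\<And>j. \<omega> n (b j) \<ominus>\<^bsub>obj B n\<^esub> b (j + \<epsilon>) = f n (x' j)"
    by (rule solve_\<omega> [OF \<epsilon> series_homs(2) [OF x']]) (rule that)
  note [simp] = series_closed(2) [OF b]
  \<comment> \<open>The differential of \<open>b\<close> is killed by \<open>\<omega>\<close> minus
    the shift because \<open>f x'\<close> is a cocycle. It therefore vanishes, which makes
    \<open>p\<close> below a cocycle too.\<close>
  have db: "diff B n (b j) = \<zero>\<^bsub>obj B (n + 1)\<^esub>" for j
  proof (rule \<omega>_recursion_unique [where z = "\<lambda>j. diff B n (b j)", OF \<epsilon> series_homs(8) [OF b]])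
    show "\<omega> (n + 1) (diff B n (b j)) \<ominus>\<^bsub>obj B (n + 1)\<^esub> diff B n (b (j + \<epsilon>)) = \<zero>\<^bsub>obj B (n + 1)\<^esub>" for j
      using arg_cong [OF b_eq [of j], of "diff B n"] by (simp add: dB.hom_minus \<omega>_def commutes dx')
  qed
  define p where "p j = t n (g n (b j))" for j
  have [simp]: "p j \<in> carrier (obj C n)" for j
    by (simp add: p_def)
  have dp: "diff C n (p j) = \<zero>\<^bsub>obj C (n + 1)\<^esub>" for j
    by (simp add: p_def commutes db)
  have p: "p \<in> module_series \<epsilon> R (obj C n)"
    unfolding p_def by (intro series_homs b)
  show thesis
  proof (rule that)
    show "(\<lambda>j. h n (p j) \<ominus>\<^bsub>obj C (n - 1)\<^esub> h n (x' j)) \<in> module_series \<epsilon> R (obj C (n - 1))"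
      by (intro series_minus series_homs p x')
    show "(\<lambda>j. w j \<oplus>\<^bsub>obj C n\<^esub> g n (b j)) \<in> module_series \<epsilon> R (obj C n)"
      by (intro module_series.add series_homs w b)
    fix j
    let ?\<theta>w = "t n (w j) \<ominus>\<^bsub>obj C n\<^esub> w (j + \<epsilon>)" and ?\<theta>b = "p j \<ominus>\<^bsub>obj C n\<^esub> g n (b (j + \<epsilon>))"
    define q where "q = diff C (n - 1) (h n (x' j))"
    have [simp]: "q \<in> carrier (obj C n)"
      by (simp add: q_def)
    \<comment> \<open>The image under \<open>g\<close> of the equation for \<open>b\<close> is
      evaluated in two ways, as \<open>g f x'\<close> and as \<open>g f p\<close> minus the shift of
      \<open>g b\<close>. The homotopy, applied to the cocycles \<open>x'\<close> and
      \<open>p\<close>, removes \<open>g f\<close> from both.\<close>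
    have "x' j \<oplus>\<^bsub>obj C n\<^esub> q = g n (\<omega> n (b j) \<ominus>\<^bsub>obj B n\<^esub> b (j + \<epsilon>))"
      by (simp add: b_eq cocycle_homotopy dx' q_def)
    also have "\<dots> = g n (f n (p j)) \<ominus>\<^bsub>obj C n\<^esub> g n (b (j + \<epsilon>))"
      by (simp add: g.hom_minus \<omega>_def p_def)
    also have "\<dots> = ?\<theta>b \<oplus>\<^bsub>obj C n\<^esub> diff C (n - 1) (h n (p j))"
      by (simp add: cocycle_homotopy dp C.add_minus_swap)
    finally have "x' j \<oplus>\<^bsub>obj C n\<^esub> q = ?\<theta>b \<oplus>\<^bsub>obj C n\<^esub> diff C (n - 1) (h n (p j))" .
    then have x'_eq: "(?\<theta>b \<oplus>\<^bsub>obj C n\<^esub> diff C (n - 1) (h n (p j))) \<ominus>\<^bsub>obj C n\<^esub> q = x' j"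
      by (subst C.minus_eq_iff) simp_all
    have x_eq: "x j = x' j \<oplus>\<^bsub>obj C n\<^esub> ?\<theta>w"
      using C.minus_eq_iff [of "x j" n ?\<theta>w "x' j"] by (simp add: x'_def)
    show "x j = diff C (n - 1) (h n (p j) \<ominus>\<^bsub>obj C (n - 1)\<^esub> h n (x' j)) \<oplus>\<^bsub>obj C n\<^esub>
        (t n (w j \<oplus>\<^bsub>obj C n\<^esub> g n (b j)) \<ominus>\<^bsub>obj C n\<^esub> (w (j + \<epsilon>) \<oplus>\<^bsub>obj C n\<^esub> g n (b (j + \<epsilon>))))"
      by (subst x_eq, subst x'_eq [symmetric], subst C.minus_add_rearrange)
        (simp_all add: dC'.hom_minus flip: p_def q_def)
  qed
qed

end

section \<open>Laurent polynomials acting on Novikov series\<close>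

definition frag_lift :: "'s set \<Rightarrow> ('g, 'f) ring_scheme \<Rightarrow> ('s \<Rightarrow> 'g) \<Rightarrow> ('s \<Rightarrow>\<^sub>0 int) \<Rightarrow> 'g"
  where "frag_lift S G f =
    (SOME h. h \<in> hom (free_Abelian_group S) (add_monoid G) \<and> (\<forall>x\<in>S. h (frag_of x) = f x))"

context abelian_group
begin

text \<open>The universal property supplies the homomorphism that \<open>SOME\<close> picks. Its
  values are determined only on combinations supported in \<open>S\<close>, whence the support
  hypotheses below.\<close>

lemma frag_lift:
  assumes "f \<in> S \<rightarrow> carrier G"
  shows "frag_lift S G f \<in> hom (free_Abelian_group S) (add_monoid G)"
    and "x \<in> S \<Longrightarrow> frag_lift S G f (frag_of x) = f x"
proof -
  have "\<exists>h. h \<in> hom (free_Abelian_group S) (add_monoid G) \<and> (\<forall>x\<in>S. h (frag_of x) = f x)"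
  proof (rule comm_group.free_Abelian_group_universal [OF a_comm_group, of f S])
    show "f ` S \<subseteq> carrier (add_monoid G)"
      using assms by auto
  qed blast
  from someI_ex [OF this] show "frag_lift S G f \<in> hom (free_Abelian_group S) (add_monoid G)"
    and "x \<in> S \<Longrightarrow> frag_lift S G f (frag_of x) = f x"
    unfolding frag_lift_def by blast+
qed

lemma frag_lift_closed:
  "\<lbrakk>f \<in> S \<rightarrow> carrier G; Poly_Mapping.keys u \<subseteq> S\<rbrakk> \<Longrightarrow> frag_lift S G f u \<in> carrier G"
  using hom_in_carrier [OF frag_lift(1), of f S u] by simp

lemma frag_lift_add:
  "\<lbrakk>f \<in> S \<rightarrow> carrier G; Poly_Mapping.keys u \<subseteq> S; Poly_Mapping.keys v \<subseteq> S\<rbrakk>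
    \<Longrightarrow> frag_lift S G f (u + v) = frag_lift S G f u \<oplus> frag_lift S G f v"
  using hom_mult [OF frag_lift(1), of f S u v] by simp

lemma frag_lift_zero: "f \<in> S \<rightarrow> carrier G \<Longrightarrow> frag_lift S G f 0 = \<zero>"
  using hom_one [OF frag_lift(1) group_free_Abelian_group a_group] by simp

lemma frag_lift_diff:
  assumes "f \<in> S \<rightarrow> carrier G" "Poly_Mapping.keys u \<subseteq> S" "Poly_Mapping.keys v \<subseteq> S"
  shows "frag_lift S G f (u - v) = frag_lift S G f u \<ominus> frag_lift S G f v"
proof -
  have k: "Poly_Mapping.keys (u - v) \<subseteq> S"
    by (rule order_trans [OF keys_diff]) (use assms in auto)
  have "frag_lift S G f (u - v) \<oplus> frag_lift S G f v = frag_lift S G f u"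
    using frag_lift_add [OF assms(1) k assms(3)] by simp
  then show ?thesis
    using add_minus_cancel [of "frag_lift S G f (u - v)" "frag_lift S G f v"] k assms
    by (simp add: frag_lift_closed)
qed

lemma finsum_minus:
  assumes "f \<in> I \<rightarrow> carrier G" "g \<in> I \<rightarrow> carrier G"
  shows "(\<Oplus>i\<in>I. f i \<ominus> g i) = (\<Oplus>i\<in>I. f i) \<ominus> (\<Oplus>i\<in>I. g i)"
  using assms
proof (induction I rule: infinite_finite_induct)
  case (insert i I)
  then have c: "f i \<in> carrier G" "g i \<in> carrier G" "finsum G f I \<in> carrier G" "finsum G g I \<in> carrier G"
    by (auto intro: finsum_closed)
  have "(\<Oplus>j\<in>insert i I. f j \<ominus> g j) = (f i \<ominus> g i) \<oplus> (finsum G f I \<ominus> finsum G g I)"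
    using insert by (subst finsum_insert) (auto simp: Pi_iff)
  also have "\<dots> = (f i \<oplus> finsum G f I) \<ominus> (g i \<oplus> finsum G g I)"
    using c by (simp add: a_minus_def minus_add a_ac)
  also have "\<dots> = finsum G f (insert i I) \<ominus> finsum G g (insert i I)"
    using insert by (simp add: finsum_insert Pi_iff)
  finally show ?case .
qed (simp_all add: minus_self)

end

section \<open>Products of series with Laurent monomials and constants\<close>

lemma series_ring_simps [simp]:
  "carrier (series_ring R S) = S"
  "zero (series_ring R S) = (\<lambda>n. \<zero>\<^bsub>R\<^esub>)"
  "one (series_ring R S) = (\<lambda>n. if n = 0 then \<one>\<^bsub>R\<^esub> else \<zero>\<^bsub>R\<^esub>)"
  "add (series_ring R S) = (\<lambda>f g n. f n \<oplus>\<^bsub>R\<^esub> g n)"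
  by (simp_all add: series_ring_def)

definition laurent_monom :: "('a, 'e) ring_scheme \<Rightarrow> int \<Rightarrow> 'a \<Rightarrow> int \<Rightarrow> 'a"
  where "laurent_monom R l r = (\<lambda>n. if n = l then r else \<zero>\<^bsub>R\<^esub>)"

abbreviation novikov_module :: "int \<Rightarrow> ('a, 'e) ring_scheme \<Rightarrow> (int \<Rightarrow> 'a, int \<Rightarrow> 'a) module"
  where "novikov_module \<epsilon> R \<equiv> left_regular_module (series_ring R (novikov_series \<epsilon> R))"

lemma left_regular_module_simps [simp]:
  "carrier (left_regular_module S) = carrier S"
  "zero (left_regular_module S) = zero S"
  "add (left_regular_module S) = add S"
  "smult (left_regular_module S) = monoid.mult S"
  by (simp_all add: left_regular_module_def)

lemma restrict_scalars_simps [simp]: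
  "carrier (restrict_scalars \<phi> M) = carrier M"
  "zero (restrict_scalars \<phi> M) = zero M"
  "add (restrict_scalars \<phi> M) = add M"
  "x \<triangleleft>\<^bsub>restrict_scalars \<phi> M\<^esub> r = x \<triangleleft>\<^bsub>M\<^esub> \<phi> r"
  by (simp_all add: restrict_scalars_def)

lemma laurent_const_eq_monom: "laurent_const R = laurent_monom R 0"
  by (intro ext) (simp add: laurent_const_def laurent_monom_def)

context ring
begin

text \<open>The index set of the Cauchy product depends on both factors and on \<open>n\<close>;
  enlarging it to a finite \<open>F\<close> only adds zero terms. A common \<open>F\<close> makes
  products comparable and sums over them additive.\<close>

lemma series_mult_eq:
  assumes "f \<in> UNIV \<rightarrow> carrier R" "g \<in> UNIV \<rightarrow> carrier R" "finite F"
    and "\<And>i. \<lbrakk>f i \<noteq> \<zero>; g (n - i) \<noteq> \<zero>\<rbrakk> \<Longrightarrow> i \<in> F"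
  shows "(f \<otimes>\<^bsub>series_ring R S\<^esub> g) n = (\<Oplus>i\<in>F. f i \<otimes> g (n - i))"
proof -
  have fg: "f i \<in> carrier R" "g i \<in> carrier R" for i
    using assms by auto
  have "(\<Oplus>i\<in>{i. f i \<noteq> \<zero> \<and> g (n - i) \<noteq> \<zero>}. f i \<otimes> g (n - i)) = (\<Oplus>i\<in>F. f i \<otimes> g (n - i))"
    using assms fg by (intro add.finprod_mono_neutral_cong_left) auto
  then show ?thesis
    by (simp add: series_ring_def)
qed

lemma laurent_monom_closed: "r \<in> carrier R \<Longrightarrow> laurent_monom R l r \<in> carrier (laurent_poly R)"
  by (auto simp: laurent_monom_def laurent_poly_def intro: finite_subset [of _ "{l}"])

lemma laurent_const_closed: "r \<in> carrier R \<Longrightarrow> laurent_const R r \<in> carrier (laurent_poly R)"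
  by (simp add: laurent_const_eq_monom laurent_monom_closed)

lemma monom_mult_eq:
  assumes "r \<in> carrier R" "g \<in> UNIV \<rightarrow> carrier R"
  shows "laurent_monom R l r \<otimes>\<^bsub>series_ring R S\<^esub> g = (\<lambda>n. r \<otimes> g (n - l))"
proof
  fix n
  have "(laurent_monom R l r \<otimes>\<^bsub>series_ring R S\<^esub> g) n = (\<Oplus>i\<in>{l}. laurent_monom R l r i \<otimes> g (n - i))"
    using assms by (intro series_mult_eq) (auto simp: laurent_monom_def split: if_splits)
  also have "\<dots> = r \<otimes> g (n - l)"
    using assms by (simp add: Pi_iff laurent_monom_def)
  finally show "(laurent_monom R l r \<otimes>\<^bsub>series_ring R S\<^esub> g) n = r \<otimes> g (n - l)" .
qed

lemma mult_const_eq: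
  assumes "r \<in> carrier R" "f \<in> UNIV \<rightarrow> carrier R"
  shows "f \<otimes>\<^bsub>series_ring R S\<^esub> laurent_const R r = (\<lambda>n. f n \<otimes> r)"
proof
  fix n
  have "(f \<otimes>\<^bsub>series_ring R S\<^esub> laurent_const R r) n = (\<Oplus>i\<in>{n}. f i \<otimes> laurent_const R r (n - i))"
    using assms by (intro series_mult_eq) (auto simp: laurent_const_def split: if_splits)
  also have "\<dots> = f n \<otimes> r"
    using assms by (simp add: Pi_iff laurent_const_def)
  finally show "(f \<otimes>\<^bsub>series_ring R S\<^esub> laurent_const R r) n = f n \<otimes> r" .
qed

lemma laurent_monom_mult:
  "\<lbrakk>r \<in> carrier R; s \<in> carrier R\<rbrakk>
    \<Longrightarrow> laurent_monom R l r \<otimes>\<^bsub>laurent_poly R\<^esub> laurent_monom R m s = laurent_monom R (l + m) (r \<otimes> s)"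
  by (subst laurent_poly_def, subst monom_mult_eq) (auto simp: laurent_monom_def fun_eq_iff)

lemma laurent_monom_add:
  "\<lbrakk>r \<in> carrier R; s \<in> carrier R\<rbrakk>
    \<Longrightarrow> laurent_monom R l (r \<oplus> s) = laurent_monom R l r \<oplus>\<^bsub>laurent_poly R\<^esub> laurent_monom R l s"
  by (auto simp: laurent_monom_def laurent_poly_def)

lemma laurent_one_eq: "\<one>\<^bsub>laurent_poly R\<^esub> = laurent_monom R 0 \<one>"
  by (simp add: laurent_poly_def laurent_monom_def)

lemma restrict_laurent_const:
  assumes "right_module (laurent_poly R) P"
  shows "right_module R (restrict_scalars (laurent_const R) P)"
proof -
  interpret P: right_module "laurent_poly R" P by fact
  have "abelian_group (restrict_scalars (laurent_const R) P)"
    using abelian_groupE [OF P.M.abelian_group_axioms] by (intro abelian_groupI) auto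
  moreover have "right_module_axioms R (restrict_scalars (laurent_const R) P)"
  proof (rule right_module_axioms.intro, unfold restrict_scalars_simps laurent_const_eq_monom)
    show "x \<triangleleft>\<^bsub>P\<^esub> laurent_monom R 0 a \<in> carrier P"
      if x: "x \<in> carrier P" and a: "a \<in> carrier R" for x a
      by (intro P.rsmult_closed x laurent_monom_closed a)
    show "(x \<oplus>\<^bsub>P\<^esub> y) \<triangleleft>\<^bsub>P\<^esub> laurent_monom R 0 a = x \<triangleleft>\<^bsub>P\<^esub> laurent_monom R 0 a \<oplus>\<^bsub>P\<^esub> y \<triangleleft>\<^bsub>P\<^esub> laurent_monom R 0 a"
      if x: "x \<in> carrier P" and y: "y \<in> carrier P" and a: "a \<in> carrier R" for x y a
      by (intro P.rsmult_add_left x y laurent_monom_closed a)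
    show "x \<triangleleft>\<^bsub>P\<^esub> laurent_monom R 0 (a \<oplus> b) = x \<triangleleft>\<^bsub>P\<^esub> laurent_monom R 0 a \<oplus>\<^bsub>P\<^esub> x \<triangleleft>\<^bsub>P\<^esub> laurent_monom R 0 b"
      if x: "x \<in> carrier P" and a: "a \<in> carrier R" and b: "b \<in> carrier R" for x a b
      using x a b by (subst laurent_monom_add) (simp_all add: P.rsmult_add_right laurent_monom_closed)
    show "x \<triangleleft>\<^bsub>P\<^esub> laurent_monom R 0 (a \<otimes> b) = x \<triangleleft>\<^bsub>P\<^esub> laurent_monom R 0 a \<triangleleft>\<^bsub>P\<^esub> laurent_monom R 0 b"
      if x: "x \<in> carrier P" and a: "a \<in> carrier R" and b: "b \<in> carrier R" for x a b
      using x a b by (subst P.rsmult_assoc [symmetric]) (simp_all add: laurent_monom_closed laurent_monom_mult)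
    show "x \<triangleleft>\<^bsub>P\<^esub> laurent_monom R 0 \<one> = x"
      if x: "x \<in> carrier P" for x
      using x P.rsmult_one by (simp flip: laurent_one_eq)
  qed
  ultimately show ?thesis
    by (intro right_module.intro ring_axioms)
qed

lemma laurent_series_closed: "a \<in> carrier (laurent_poly R) \<Longrightarrow> a \<in> UNIV \<rightarrow> carrier R"
  by (simp add: laurent_poly_def)

text \<open>Lower bounds for the exponents, ordered by \<open>\<epsilon> * i\<close>, add under
  multiplication. The product formula is independent of the carrier, so \<open>S\<close> is
  arbitrary.\<close>

lemma laurent_mult_novikov_closed:
  assumes a: "a \<in> carrier (laurent_poly R)" and b: "b \<in> novikov_series \<epsilon> R" and \<epsilon>: "\<epsilon> = 1 \<or> \<epsilon> = -1"
  shows "a \<otimes>\<^bsub>series_ring R S\<^esub> b \<in> novikov_series \<epsilon> R"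
proof -
  have ab: "a \<in> UNIV \<rightarrow> carrier R" "b \<in> UNIV \<rightarrow> carrier R" and fin: "finite {i. a i \<noteq> \<zero>}"
    using a b by (auto simp: laurent_poly_def novikov_series_def)
  then have *: "(a \<otimes>\<^bsub>series_ring R S\<^esub> b) n = (\<Oplus>i\<in>{i. a i \<noteq> \<zero>}. a i \<otimes> b (n - i))" for n
    by (intro series_mult_eq) auto
  have ab': "a i \<in> carrier R" "b i \<in> carrier R" for i
    using ab by auto
  obtain k where k: "\<And>i. \<epsilon> * i < k \<Longrightarrow> b i = \<zero>"
    using b by (auto simp: novikov_series_def)
  \<comment> \<open>For \<open>a = 0\<close> the minimum over the empty set is unspecified, but then
    the bound is vacuous.\<close>
  obtain l where l: "\<And>i. a i \<noteq> \<zero> \<Longrightarrow> l \<le> \<epsilon> * i"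
  proof
    show "Min ((\<lambda>i. \<epsilon> * i) ` {i. a i \<noteq> \<zero>}) \<le> \<epsilon> * i" if "a i \<noteq> \<zero>" for i
      using fin that by (intro Min_le) auto
  qed
  have "(a \<otimes>\<^bsub>series_ring R S\<^esub> b) n = \<zero>" if n: "\<epsilon> * n < k + l" for n
    unfolding *
  proof (intro add.finprod_one_eqI ballI)
    fix i assume "i \<in> {i. a i \<noteq> \<zero>}"
    then have "\<epsilon> * (n - i) < k"
      using l [of i] n by (simp add: right_diff_distrib)
    then show "a i \<otimes> b (n - i) = \<zero>"
      using k ab' by simp
  qed
  then show ?thesis
    unfolding novikov_series_def using * ab' by (auto intro!: finsum_closed)
qed

lemma abelian_group_novikov_module: "abelian_group (novikov_module \<epsilon> R)"
proof (rule abelian_groupI; clarsimp)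
  fix x y assume xy: "x \<in> novikov_series \<epsilon> R" "y \<in> novikov_series \<epsilon> R"
  then obtain k l where "\<forall>i. \<epsilon> * i < k \<longrightarrow> x i = \<zero>" "\<forall>i. \<epsilon> * i < l \<longrightarrow> y i = \<zero>"
    by (auto simp: novikov_series_def)
  then have "\<forall>i. \<epsilon> * i < min k l \<longrightarrow> x i \<oplus> y i = \<zero>"
    by auto
  then have "\<exists>k. \<forall>i. \<epsilon> * i < k \<longrightarrow> x i \<oplus> y i = \<zero>" ..
  then show "(\<lambda>n. x n \<oplus> y n) \<in> novikov_series \<epsilon> R"
    using xy by (auto simp: novikov_series_def)
  show "(\<lambda>n. x n \<oplus> y n) = (\<lambda>n. y n \<oplus> x n)"
    using xy by (auto simp: novikov_series_closed a_comm)
next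
  fix x assume x: "x \<in> novikov_series \<epsilon> R"
  then have "(\<lambda>n. \<ominus> x n) \<in> novikov_series \<epsilon> R"
    by (force simp: novikov_series_def)
  moreover have "(\<lambda>n. \<ominus> x n \<oplus> x n) = (\<lambda>n. \<zero>)"
    using x by (auto simp: novikov_series_closed l_neg)
  ultimately show "\<exists>y\<in>novikov_series \<epsilon> R. (\<lambda>n. y n \<oplus> x n) = (\<lambda>n. \<zero>)"
    by (intro bexI [of _ "\<lambda>n. \<ominus> x n"])
qed (auto simp: novikov_series_closed a_assoc zero_novikov_series)

end

section \<open>The tensor product as a cokernel\<close>

lemma a_inv_restrict_scalars [simp]: "a_inv (restrict_scalars \<phi> M) = a_inv M"
  by (simp add: a_inv_def m_inv_def fun_eq_iff)

locale laurent_novikov = R: ring R + P: right_module "laurent_poly R" P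
  for R :: "('a, 'e) ring_scheme" and P :: "(int \<Rightarrow> 'a, 'b, 'f) right_module_scheme" +
  fixes \<epsilon> :: int
  assumes \<epsilon>: "\<epsilon> = 1 \<or> \<epsilon> = -1"
begin

sublocale Q: right_module R "restrict_scalars (laurent_const R) P"
  by (rule R.restrict_laurent_const [OF P.right_module_axioms])

sublocale N: abelian_group "novikov_module \<epsilon> R"
  by (rule R.abelian_group_novikov_module)

definition "frags = {u. Poly_Mapping.keys u \<subseteq> carrier P \<times> novikov_series \<epsilon> R}"
abbreviation "relators \<equiv> tensor_subgroup (laurent_poly R) P (novikov_module \<epsilon> R)"

text \<open>The map sending \<open>x \<otimes> a\<close> to the series with coefficients
  \<open>x a_j\<close>, on formal sums. It is lifted one coefficient at a time, so that the target
  group is \<open>P\<close> itself.\<close>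

definition series_of :: "('b \<times> (int \<Rightarrow> 'a) \<Rightarrow>\<^sub>0 int) \<Rightarrow> int \<Rightarrow> 'b" where
  "series_of u j = frag_lift (carrier P \<times> novikov_series \<epsilon> R) P (\<lambda>(x, a). x \<triangleleft>\<^bsub>P\<^esub> laurent_const R (a j)) u"

text \<open>This is \<open>t \<otimes> 1 - 1 \<otimes> t\<close> for \<open>t = z\<^sup>-\<^sup>\<epsilon>\<close>: multiplying a series by \<open>z\<^sup>-\<^sup>\<epsilon>\<close> shifts its coefficients by \<open>\<epsilon>\<close>.\<close>

definition twisted_diff :: "(int \<Rightarrow> 'b) \<Rightarrow> int \<Rightarrow> 'b" where
  "twisted_diff c j = c j \<triangleleft>\<^bsub>P\<^esub> laurent_monom R (- \<epsilon>) \<one>\<^bsub>R\<^esub> \<ominus>\<^bsub>P\<^esub> c (j + \<epsilon>)"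

abbreviation "mseries \<equiv> module_series \<epsilon> R (restrict_scalars (laurent_const R) P)"

abbreviation "twisted_diffs \<equiv> twisted_diff ` mseries"

section \<open>Formal sums of pairs, their series, and the tensor relations\<close>

lemma const_hom: "x \<in> carrier P \<Longrightarrow> abelian_group_hom R P (\<lambda>r. x \<triangleleft>\<^bsub>P\<^esub> laurent_const R r)"
  using Q.rsmult_add_right [of x]
  by (intro additive_abelian_group_homI R.abelian_group_axioms P.M.abelian_group_axioms)
    (simp_all add: P.rsmult_closed R.laurent_const_closed)

lemma series_of_fun: "(\<lambda>(x, a). x \<triangleleft>\<^bsub>P\<^esub> laurent_const R (a j)) \<in> carrier P \<times> novikov_series \<epsilon> R \<rightarrow> carrier P"
  by (auto simp: P.rsmult_closed R.laurent_const_closed novikov_series_closed)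

lemma series_of_closed: "u \<in> frags \<Longrightarrow> series_of u j \<in> carrier P"
  unfolding series_of_def by (rule P.frag_lift_closed [OF series_of_fun]) (simp add: frags_def)

lemma series_of_add: "\<lbrakk>u \<in> frags; v \<in> frags\<rbrakk> \<Longrightarrow> series_of (u + v) j = series_of u j \<oplus>\<^bsub>P\<^esub> series_of v j"
  unfolding series_of_def by (rule P.frag_lift_add [OF series_of_fun]) (simp_all add: frags_def)

lemma series_of_diff: "\<lbrakk>u \<in> frags; v \<in> frags\<rbrakk> \<Longrightarrow> series_of (u - v) j = series_of u j \<ominus>\<^bsub>P\<^esub> series_of v j"
  unfolding series_of_def by (rule P.frag_lift_diff [OF series_of_fun]) (simp_all add: frags_def)

lemma series_of_gen: "\<lbrakk>x \<in> carrier P; a \<in> novikov_series \<epsilon> R\<rbrakk> \<Longrightarrow> series_of (frag_of (x, a)) j = x \<triangleleft>\<^bsub>P\<^esub> laurent_const R (a j)"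
  unfolding series_of_def by (subst P.frag_lift(2) [OF series_of_fun]) simp_all

lemma series_of_zero: "series_of 0 j = \<zero>\<^bsub>P\<^esub>"
  unfolding series_of_def by (rule P.frag_lift_zero [OF series_of_fun])

lemma frags_gen: "\<lbrakk>x \<in> carrier P; a \<in> novikov_series \<epsilon> R\<rbrakk> \<Longrightarrow> frag_of (x, a) \<in> frags"
  by (simp add: frags_def)

lemma frags_add: "\<lbrakk>u \<in> frags; v \<in> frags\<rbrakk> \<Longrightarrow> u + v \<in> frags"
  using Poly_Mapping.keys_add [of u v] by (auto simp: frags_def)

lemma frags_diff: "\<lbrakk>u \<in> frags; v \<in> frags\<rbrakk> \<Longrightarrow> u - v \<in> frags"
  using keys_diff [of u v] by (auto simp: frags_def)

lemma frags_zero: "0 \<in> frags"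
  by (simp add: frags_def)

lemma frags_minus: "u \<in> frags \<Longrightarrow> - u \<in> frags"
  by (simp add: frags_def)

lemmas frags_intros [simp] = frags_gen frags_add frags_diff frags_zero frags_minus

lemma laurent_mult_closed:
  "\<lbrakk>a \<in> carrier (laurent_poly R); b \<in> novikov_series \<epsilon> R\<rbrakk>
    \<Longrightarrow> a \<otimes>\<^bsub>series_ring R (novikov_series \<epsilon> R)\<^esub> b \<in> novikov_series \<epsilon> R"
  by (rule R.laurent_mult_novikov_closed [OF _ _ \<epsilon>])

lemma novikov_add_closed:
  "\<lbrakk>a \<in> novikov_series \<epsilon> R; b \<in> novikov_series \<epsilon> R\<rbrakk> \<Longrightarrow> (\<lambda>n. a n \<oplus>\<^bsub>R\<^esub> b n) \<in> novikov_series \<epsilon> R"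
  using N.a_closed [of a b] by simp

lemma relations_subset: "tensor_relations (laurent_poly R) P (novikov_module \<epsilon> R) \<subseteq> frags"
  unfolding tensor_relations_def
  by (intro Un_least subsetI; elim CollectE exE conjE; hypsubst)
    (intro frags_diff frags_gen; simp add: novikov_add_closed laurent_mult_closed P.rsmult_closed)+

lemma relators_subgroup: "subgroup relators (free_Abelian_group (carrier P \<times> novikov_series \<epsilon> R))"
  unfolding tensor_subgroup_def left_regular_module_simps series_ring_simps
  by (rule group.generate_is_subgroup) (use relations_subset in \<open>auto simp: frags_def\<close>)

lemma relators_frags: "u \<in> relators \<Longrightarrow> u \<in> frags"
  using subgroup.mem_carrier [OF relators_subgroup] by (simp add: frags_def)

lemma relators_zero: "0 \<in> relators"
  using subgroup.one_closed [OF relators_subgroup] by simp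

lemma relators_add: "\<lbrakk>u \<in> relators; v \<in> relators\<rbrakk> \<Longrightarrow> u + v \<in> relators"
  using subgroup.m_closed [OF relators_subgroup] by simp

lemma relators_minus: "u \<in> relators \<Longrightarrow> - u \<in> relators"
  using subgroup.m_inv_closed [OF relators_subgroup] relators_frags by (simp add: frags_def)

lemma relators_diff: "\<lbrakk>u \<in> relators; v \<in> relators\<rbrakk> \<Longrightarrow> u - v \<in> relators"
  using relators_add [OF _ relators_minus] by fastforce

lemma relators_sum: "(\<And>i. i \<in> I \<Longrightarrow> u i \<in> relators) \<Longrightarrow> sum u I \<in> relators"
  by (induction I rule: infinite_finite_induct) (simp_all add: relators_zero relators_add)

lemma relation_in_relators:
  "u \<in> tensor_relations (laurent_poly R) P (novikov_module \<epsilon> R) \<Longrightarrow> u \<in> relators"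
  unfolding tensor_subgroup_def by (rule generate.incl)

lemma relator_add_left:
  "\<lbrakk>x \<in> carrier P; x' \<in> carrier P; a \<in> novikov_series \<epsilon> R\<rbrakk>
    \<Longrightarrow> frag_of (x \<oplus>\<^bsub>P\<^esub> x', a) - frag_of (x, a) - frag_of (x', a) \<in> relators"
  by (rule relation_in_relators) (force simp: tensor_relations_def)

lemma relator_add_right:
  "\<lbrakk>x \<in> carrier P; a \<in> novikov_series \<epsilon> R; b \<in> novikov_series \<epsilon> R\<rbrakk>
    \<Longrightarrow> frag_of (x, a \<oplus>\<^bsub>novikov_module \<epsilon> R\<^esub> b) - frag_of (x, a) - frag_of (x, b) \<in> relators"
  by (rule relation_in_relators) (unfold tensor_relations_def, force)

lemma relator_balance:
  "\<lbrakk>x \<in> carrier P; a \<in> carrier (laurent_poly R); b \<in> novikov_series \<epsilon> R\<rbrakk>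
    \<Longrightarrow> frag_of (x \<triangleleft>\<^bsub>P\<^esub> a, b) - frag_of (x, a \<otimes>\<^bsub>series_ring R (novikov_series \<epsilon> R)\<^esub> b) \<in> relators"
  by (rule relation_in_relators) (unfold tensor_relations_def, force)

section \<open>Series over \<open>P\<close> and the image of the twisted difference\<close>

lemma mseries_closed: "c \<in> mseries \<Longrightarrow> c j \<in> carrier P"
  using Q.module_series_closed [of c \<epsilon> j] by simp

lemma mseries_ops:
  "\<lbrakk>c \<in> mseries; c' \<in> mseries\<rbrakk> \<Longrightarrow> (\<lambda>j. c j \<oplus>\<^bsub>P\<^esub> c' j) \<in> mseries"
  "c \<in> mseries \<Longrightarrow> (\<lambda>j. \<ominus>\<^bsub>P\<^esub> c j) \<in> mseries"
  "(\<lambda>j. \<zero>\<^bsub>P\<^esub>) \<in> mseries"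
  using module_series.add [of c \<epsilon> R "restrict_scalars (laurent_const R) P" c'] Q.module_series_inv [of c \<epsilon>] Q.module_series_zero [of \<epsilon>]
  by simp_all

lemma mseries_gen:
  "\<lbrakk>x \<in> carrier P; a \<in> novikov_series \<epsilon> R\<rbrakk> \<Longrightarrow> (\<lambda>j. x \<triangleleft>\<^bsub>P\<^esub> laurent_const R (a j)) \<in> mseries"
  using module_series.gen [of x "restrict_scalars (laurent_const R) P" a \<epsilon> R] by simp

text \<open>The indeterminate commutes with \<open>R\<close>, so multiplication by
  \<open>z^l\<close> remains linear after restriction of scalars, and hence acts on series
  coefficientwise.\<close>

lemma monom_hom:
  "(\<lambda>x. x \<triangleleft>\<^bsub>P\<^esub> laurent_monom R l \<one>\<^bsub>R\<^esub>)
    \<in> right_module_hom R (restrict_scalars (laurent_const R) P) (restrict_scalars (laurent_const R) P)"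
  unfolding right_module_hom_def laurent_const_eq_monom
  by (auto simp: P.rsmult_closed P.rsmult_add_left R.laurent_monom_closed R.laurent_monom_mult
      simp flip: P.rsmult_assoc)

lemma mseries_monom:
  "c \<in> mseries \<Longrightarrow> (\<lambda>j. c j \<triangleleft>\<^bsub>P\<^esub> laurent_monom R l \<one>\<^bsub>R\<^esub>) \<in> mseries"
  by (rule module_series_hom [OF monom_hom Q.right_module_axioms]) simp_all

lemma twisted_diff_add:
  assumes "c \<in> mseries" "c' \<in> mseries"
  shows "twisted_diff (\<lambda>j. c j \<oplus>\<^bsub>P\<^esub> c' j) j = twisted_diff c j \<oplus>\<^bsub>P\<^esub> twisted_diff c' j"
proof -
  have *: "c j \<in> carrier P" "c' j \<in> carrier P" for j
    using assms by (simp_all add: mseries_closed)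
  then have "c j \<triangleleft>\<^bsub>P\<^esub> laurent_monom R l \<one>\<^bsub>R\<^esub> \<in> carrier P" "c' j \<triangleleft>\<^bsub>P\<^esub> laurent_monom R l \<one>\<^bsub>R\<^esub> \<in> carrier P" for j l
    by (simp_all add: P.rsmult_closed R.laurent_monom_closed)
  with * show ?thesis
    by (simp add: twisted_diff_def P.rsmult_add_left R.laurent_monom_closed)
      (simp add: a_minus_def P.M.minus_add P.M.a_ac)
qed

lemma twisted_diff_inv:
  assumes "c \<in> mseries"
  shows "twisted_diff (\<lambda>j. \<ominus>\<^bsub>P\<^esub> c j) j = \<ominus>\<^bsub>P\<^esub> twisted_diff c j"
proof -
  have *: "c j \<in> carrier P" for j
    using assms by (simp add: mseries_closed)
  then have "c j \<triangleleft>\<^bsub>P\<^esub> laurent_monom R l \<one>\<^bsub>R\<^esub> \<in> carrier P" for j l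
    by (simp add: P.rsmult_closed R.laurent_monom_closed)
  with * show ?thesis
    by (simp add: twisted_diff_def P.inv_rsmult R.laurent_monom_closed a_minus_def P.M.minus_add)
qed

lemma twisted_diffs_add:
  assumes "e \<in> twisted_diffs" "e' \<in> twisted_diffs"
  shows "(\<lambda>j. e j \<oplus>\<^bsub>P\<^esub> e' j) \<in> twisted_diffs"
proof -
  obtain c c' where c: "c \<in> mseries" "e = twisted_diff c" "c' \<in> mseries" "e' = twisted_diff c'"
    using assms by blast
  then have "(\<lambda>j. e j \<oplus>\<^bsub>P\<^esub> e' j) = twisted_diff (\<lambda>j. c j \<oplus>\<^bsub>P\<^esub> c' j)"
    by (simp add: fun_eq_iff twisted_diff_add)
  then show ?thesis
    using mseries_ops(1) [OF c(1,3)] by blast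
qed

lemma twisted_diffs_inv:
  assumes "e \<in> twisted_diffs"
  shows "(\<lambda>j. \<ominus>\<^bsub>P\<^esub> e j) \<in> twisted_diffs"
proof -
  obtain c where c: "c \<in> mseries" "e = twisted_diff c"
    using assms by blast
  then have "(\<lambda>j. \<ominus>\<^bsub>P\<^esub> e j) = twisted_diff (\<lambda>j. \<ominus>\<^bsub>P\<^esub> c j)"
    by (simp add: fun_eq_iff twisted_diff_inv)
  then show ?thesis
    using mseries_ops(2) [OF c(1)] by blast
qed

lemma twisted_diffs_zero: "(\<lambda>j. \<zero>\<^bsub>P\<^esub>) \<in> twisted_diffs"
  using mseries_ops(3)
  by (auto simp: fun_eq_iff twisted_diff_def P.zero_rsmult R.laurent_monom_closed P.M.minus_self
      intro!: image_eqI [where x = "\<lambda>j. \<zero>\<^bsub>P\<^esub>"])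

lemma twisted_diffs_closed:
  assumes "e \<in> twisted_diffs"
  shows "e j \<in> carrier P"
proof -
  obtain c where "c \<in> mseries" "e = twisted_diff c"
    using assms by blast
  then show ?thesis
    by (simp add: twisted_diff_def P.rsmult_closed R.laurent_monom_closed mseries_closed)
qed

lemma twisted_diffs_finsum:
  assumes "finite I" "\<And>i. i \<in> I \<Longrightarrow> e i \<in> twisted_diffs"
  shows "(\<lambda>j. \<Oplus>\<^bsub>P\<^esub>i\<in>I. e i j) \<in> twisted_diffs"
  using assms
proof induction
  case (insert i I)
  have "(\<lambda>j. \<Oplus>\<^bsub>P\<^esub>i\<in>insert i I. e i j) = (\<lambda>j. e i j \<oplus>\<^bsub>P\<^esub> (\<Oplus>\<^bsub>P\<^esub>i\<in>I. e i j))"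
    using insert.hyps insert.prems [THEN twisted_diffs_closed]
    by (intro ext P.M.finsum_insert) auto
  with insert show ?case
    by (simp add: twisted_diffs_add)
qed (simp add: twisted_diffs_zero)

text \<open>Telescoping with \<open>t = z^(-\<epsilon>)\<close>: the value of
  \<open>t^(k+1) \<otimes> 1 - 1 \<otimes> t^(k+1)\<close> at \<open>c\<close> is that of
  \<open>t^k \<otimes> 1 - 1 \<otimes> t^k\<close> at \<open>c t\<close> plus that of
  \<open>t \<otimes> 1 - 1 \<otimes> t\<close> at \<open>c\<close> shifted by \<open>k\<close>
  steps.\<close>

lemma monom_shift_twisted_diff_pos:
  assumes "c \<in> mseries"
  shows "(\<lambda>j. c j \<triangleleft>\<^bsub>P\<^esub> laurent_monom R (- \<epsilon> * int k) \<one>\<^bsub>R\<^esub> \<ominus>\<^bsub>P\<^esub> c (j + \<epsilon> * int k)) \<in> twisted_diffs"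
  using assms
proof (induction k arbitrary: c)
  case 0
  then have "(\<lambda>j. c j \<triangleleft>\<^bsub>P\<^esub> laurent_monom R 0 \<one>\<^bsub>R\<^esub> \<ominus>\<^bsub>P\<^esub> c j) = (\<lambda>j. \<zero>\<^bsub>P\<^esub>)"
    by (simp add: P.rsmult_one mseries_closed P.M.minus_self flip: R.laurent_one_eq)
  then show ?case
    by (simp add: twisted_diffs_zero)
next
  case (Suc k)
  let ?t = "laurent_monom R (- \<epsilon>) \<one>\<^bsub>R\<^esub>" and ?tk = "laurent_monom R (- \<epsilon> * int k) \<one>\<^bsub>R\<^esub>"
  have t: "?t \<in> carrier (laurent_poly R)" "?tk \<in> carrier (laurent_poly R)"
    by (simp_all add: R.laurent_monom_closed)
  have e: "(\<lambda>j. c j \<triangleleft>\<^bsub>P\<^esub> ?t \<triangleleft>\<^bsub>P\<^esub> ?tk \<ominus>\<^bsub>P\<^esub> c (j + \<epsilon> * int k) \<triangleleft>\<^bsub>P\<^esub> ?t) \<in> twisted_diffs"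
    by (rule Suc.IH [OF mseries_monom [OF Suc.prems]])
  have e': "twisted_diff (\<lambda>j. c (j + \<epsilon> * int k)) \<in> twisted_diffs"
    by (intro imageI module_series_shift Suc.prems)
  have "c j \<triangleleft>\<^bsub>P\<^esub> laurent_monom R (- \<epsilon> * int (Suc k)) \<one>\<^bsub>R\<^esub> \<ominus>\<^bsub>P\<^esub> c (j + \<epsilon> * int (Suc k))
      = (c j \<triangleleft>\<^bsub>P\<^esub> ?t \<triangleleft>\<^bsub>P\<^esub> ?tk \<ominus>\<^bsub>P\<^esub> c (j + \<epsilon> * int k) \<triangleleft>\<^bsub>P\<^esub> ?t)
        \<oplus>\<^bsub>P\<^esub> twisted_diff (\<lambda>j. c (j + \<epsilon> * int k)) j" for j
  proof -
    have "c j \<triangleleft>\<^bsub>P\<^esub> laurent_monom R (- \<epsilon> * int (Suc k)) \<one>\<^bsub>R\<^esub> = c j \<triangleleft>\<^bsub>P\<^esub> ?t \<triangleleft>\<^bsub>P\<^esub> ?tk"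
      using mseries_closed [OF Suc.prems]
      by (simp add: R.laurent_monom_closed R.laurent_monom_mult algebra_simps flip: P.rsmult_assoc)
    moreover have "j + \<epsilon> * int (Suc k) = j + \<epsilon> + \<epsilon> * int k"
      by (simp add: algebra_simps)
    ultimately show ?thesis
      using mseries_closed [OF Suc.prems] t
      by (simp only: twisted_diff_def) (simp add: P.rsmult_closed P.M.minus_add_minus_cancel)
  qed
  then show ?case
    using twisted_diffs_add [OF e e'] by presburger
qed

text \<open>For \<open>\<epsilon> * l \<le> 0\<close> the monomial is a power of \<open>t\<close>.
  Otherwise its inverse is, and the previous lemma is applied to a suitably multiplied
  series.\<close>

lemma monom_shift_twisted_diff:
  assumes c: "c \<in> mseries"
  shows "(\<lambda>j. c j \<triangleleft>\<^bsub>P\<^esub> laurent_monom R l \<one>\<^bsub>R\<^esub> \<ominus>\<^bsub>P\<^esub> c (j - l)) \<in> twisted_diffs"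
proof (cases "\<epsilon> * l \<le> 0")
  case True
  define k where "k = nat (- \<epsilon> * l)"
  have "l = - \<epsilon> * int k"
    using True \<epsilon> by (auto simp: k_def)
  then show ?thesis
    using monom_shift_twisted_diff_pos [OF c, of k] by simp
next
  case False
  define k where "k = nat (\<epsilon> * l)"
  have l: "l = \<epsilon> * int k"
    using False \<epsilon> by (auto simp: k_def)
  \<comment> \<open>Multiplying both tensor factors by \<open>z^l\<close> makes the difference for
    \<open>z^(-l)\<close> at \<open>e\<close> the negative of the difference for \<open>z^l\<close>
    at \<open>c\<close>.\<close>
  define e where "e j = c (j - l) \<triangleleft>\<^bsub>P\<^esub> laurent_monom R l \<one>\<^bsub>R\<^esub>" for j
  have e: "e \<in> mseries"
    unfolding e_def using mseries_monom [OF module_series_shift [OF c, of "- l"]] by simp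
  have "e j \<triangleleft>\<^bsub>P\<^esub> laurent_monom R (- l) \<one>\<^bsub>R\<^esub> = c (j - l)" for j
    using mseries_closed [OF c]
    by (simp add: e_def R.laurent_monom_closed R.laurent_monom_mult P.rsmult_one
        flip: P.rsmult_assoc R.laurent_one_eq)
  moreover have "e (j + l) = c j \<triangleleft>\<^bsub>P\<^esub> laurent_monom R l \<one>\<^bsub>R\<^esub>" for j
    by (simp add: e_def)
  ultimately have "(\<lambda>j. c (j - l) \<ominus>\<^bsub>P\<^esub> c j \<triangleleft>\<^bsub>P\<^esub> laurent_monom R l \<one>\<^bsub>R\<^esub>) \<in> twisted_diffs"
    using monom_shift_twisted_diff_pos [OF e, of k] by (simp flip: l)
  from twisted_diffs_inv [OF this] show ?thesis
    using mseries_closed [OF c]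
    by (simp add: a_minus_def P.M.minus_add P.rsmult_closed R.laurent_monom_closed P.M.a_comm)
qed

section \<open>Relators correspond to twisted differences\<close>

lemma laurent_eval_hom: "abelian_group_hom (laurent_poly R) R (\<lambda>a. a n)"
  by (rule additive_abelian_group_homI [OF P.A.abelian_group_axioms R.abelian_group_axioms])
    (auto simp: laurent_poly_def)

lemma laurent_decomposition:
  assumes a: "a \<in> carrier (laurent_poly R)"
  shows "a = (\<Oplus>\<^bsub>laurent_poly R\<^esub>l\<in>{l. a l \<noteq> \<zero>\<^bsub>R\<^esub>}. laurent_monom R l (a l))"
proof
  fix n
  let ?F = "{l. a l \<noteq> \<zero>\<^bsub>R\<^esub>}"
  have ac: "a l \<in> carrier R" for l
    using a by (auto simp: laurent_poly_def)
  have "(\<Oplus>\<^bsub>laurent_poly R\<^esub>l\<in>?F. laurent_monom R l (a l)) n = (\<Oplus>\<^bsub>R\<^esub>l\<in>?F. laurent_monom R l (a l) n)"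
    by (rule abelian_group_hom.hom_finsum [OF laurent_eval_hom]) (auto simp: R.laurent_monom_closed ac)
  also have "\<dots> = (\<Oplus>\<^bsub>R\<^esub>l\<in>?F \<inter> {n}. a n)"
    using a ac by (intro R.add.finprod_mono_neutral_cong_right) (auto simp: laurent_monom_def laurent_poly_def)
  also have "\<dots> = a n"
    using ac by (cases "a n = \<zero>\<^bsub>R\<^esub>") (auto simp: Pi_iff)
  finally show "a n = (\<Oplus>\<^bsub>laurent_poly R\<^esub>l\<in>?F. laurent_monom R l (a l)) n" ..
qed

text \<open>Splitting \<open>a\<close> into monomials \<open>a_l z^l\<close> reduces the balancing
  relation to single monomials. There the coefficient \<open>a_l\<close> passes through the tensor
  sign on the level of series, and only \<open>z^l \<otimes> 1 - 1 \<otimes> z^l\<close>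
  remains.\<close>

lemma balance_twisted_diff:
  assumes x: "x \<in> carrier P" and a: "a \<in> carrier (laurent_poly R)" and b: "b \<in> novikov_series \<epsilon> R"
  shows "series_of (frag_of (x \<triangleleft>\<^bsub>P\<^esub> a, b) - frag_of (x, a \<otimes>\<^bsub>series_ring R (novikov_series \<epsilon> R)\<^esub> b)) \<in> twisted_diffs"
proof -
  let ?F = "{l. a l \<noteq> \<zero>\<^bsub>R\<^esub>}" and ?K = "laurent_const R" and ?ab = "a \<otimes>\<^bsub>series_ring R (novikov_series \<epsilon> R)\<^esub> b"
  have fin: "finite ?F" and ac: "a l \<in> carrier R" and bc: "b l \<in> carrier R" for l
    using a b by (auto simp: laurent_poly_def novikov_series_def)
  \<comment> \<open>\<open>e l\<close> is the contribution of degree \<open>l\<close>, namely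
    \<open>z^l \<otimes> 1 - 1 \<otimes> z^l\<close> evaluated at the series of
    \<open>x a_l \<otimes> b\<close>.\<close>
  define e where "e l j = x \<triangleleft>\<^bsub>P\<^esub> ?K (a l) \<triangleleft>\<^bsub>P\<^esub> ?K (b j) \<triangleleft>\<^bsub>P\<^esub> laurent_monom R l \<one>\<^bsub>R\<^esub>
      \<ominus>\<^bsub>P\<^esub> x \<triangleleft>\<^bsub>P\<^esub> ?K (a l) \<triangleleft>\<^bsub>P\<^esub> ?K (b (j - l))" for l j
  have "e l \<in> twisted_diffs" for l
    unfolding e_def
    by (rule monom_shift_twisted_diff [OF mseries_gen]) (simp_all add: x b ac P.rsmult_closed R.laurent_const_closed)
  then have sum_e: "(\<lambda>j. \<Oplus>\<^bsub>P\<^esub>l\<in>?F. e l j) \<in> twisted_diffs"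
    using fin by (intro twisted_diffs_finsum)
  \<comment> \<open>Because \<open>z^l\<close> commutes with constants, it can be moved past
    \<open>b_j\<close> to join \<open>a_l\<close>.\<close>
  have e_eq: "e l j = x \<triangleleft>\<^bsub>P\<^esub> laurent_monom R l (a l) \<triangleleft>\<^bsub>P\<^esub> ?K (b j) \<ominus>\<^bsub>P\<^esub> x \<triangleleft>\<^bsub>P\<^esub> ?K (a l \<otimes>\<^bsub>R\<^esub> b (j - l))" for l j
    using x ac bc
    by (simp add: e_def laurent_const_eq_monom R.laurent_monom_closed R.laurent_monom_mult flip: P.rsmult_assoc)
  have "series_of (frag_of (x \<triangleleft>\<^bsub>P\<^esub> a, b) - frag_of (x, ?ab)) j = (\<Oplus>\<^bsub>P\<^esub>l\<in>?F. e l j)" for j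
  proof -
    have "x \<triangleleft>\<^bsub>P\<^esub> a \<triangleleft>\<^bsub>P\<^esub> ?K (b j) = (\<Oplus>\<^bsub>P\<^esub>l\<in>?F. x \<triangleleft>\<^bsub>P\<^esub> laurent_monom R l (a l) \<triangleleft>\<^bsub>P\<^esub> ?K (b j))"
    proof -
      have "x \<triangleleft>\<^bsub>P\<^esub> a = (\<Oplus>\<^bsub>P\<^esub>l\<in>?F. x \<triangleleft>\<^bsub>P\<^esub> laurent_monom R l (a l))"
        using abelian_group_hom.hom_finsum [OF P.scalar_abelian_group_hom [OF x], of "\<lambda>l. laurent_monom R l (a l)" ?F]
        by (simp add: R.laurent_monom_closed ac flip: laurent_decomposition [OF a])
      then show ?thesis
        using abelian_group_hom.hom_finsum [OF P.rsmult_abelian_group_hom [OF R.laurent_const_closed [OF bc]],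
            of "\<lambda>l. x \<triangleleft>\<^bsub>P\<^esub> laurent_monom R l (a l)" ?F j]
        by (simp add: P.rsmult_closed x R.laurent_monom_closed ac)
    qed
    moreover have "x \<triangleleft>\<^bsub>P\<^esub> ?K (?ab j) = (\<Oplus>\<^bsub>P\<^esub>l\<in>?F. x \<triangleleft>\<^bsub>P\<^esub> ?K (a l \<otimes>\<^bsub>R\<^esub> b (j - l)))"
    proof -
      have "?ab j = (\<Oplus>\<^bsub>R\<^esub>l\<in>?F. a l \<otimes>\<^bsub>R\<^esub> b (j - l))"
        using fin ac bc by (intro R.series_mult_eq) auto
      then show ?thesis
        using abelian_group_hom.hom_finsum [OF const_hom [OF x], of "\<lambda>l. a l \<otimes>\<^bsub>R\<^esub> b (j - l)" ?F]
        by (simp add: ac bc)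
    qed
    ultimately show ?thesis
      unfolding e_eq using x a b ac bc
      by (simp add: series_of_diff series_of_gen laurent_mult_closed P.rsmult_closed P.M.finsum_minus
          R.laurent_monom_closed R.laurent_const_closed)
  qed
  then show ?thesis
    using sum_e by presburger
qed

text \<open>Inverses and products in the generated subgroup are rewritten as \<open>0 - u\<close>
  and \<open>u - (0 - v)\<close>, so closure under differences is the only inductive case.
  Membership in \<open>frags\<close> is carried along, as additivity of \<open>series_of\<close>
  requires it.\<close>

lemma relators_induct [consumes 1, case_names zero add_left add_right balance diff]:
  assumes "u \<in> relators" and "Q 0"
    and "\<And>x x' b. \<lbrakk>x \<in> carrier P; x' \<in> carrier P; b \<in> novikov_series \<epsilon> R\<rbrakk>
      \<Longrightarrow> Q (frag_of (x \<oplus>\<^bsub>P\<^esub> x', b) - frag_of (x, b) - frag_of (x', b))"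
    and "\<And>x b b'. \<lbrakk>x \<in> carrier P; b \<in> novikov_series \<epsilon> R; b' \<in> novikov_series \<epsilon> R\<rbrakk>
      \<Longrightarrow> Q (frag_of (x, \<lambda>n. b n \<oplus>\<^bsub>R\<^esub> b' n) - frag_of (x, b) - frag_of (x, b'))"
    and "\<And>x a b. \<lbrakk>x \<in> carrier P; a \<in> carrier (laurent_poly R); b \<in> novikov_series \<epsilon> R\<rbrakk>
      \<Longrightarrow> Q (frag_of (x \<triangleleft>\<^bsub>P\<^esub> a, b) - frag_of (x, a \<otimes>\<^bsub>series_ring R (novikov_series \<epsilon> R)\<^esub> b))"
    and diff: "\<And>u v. \<lbrakk>u \<in> frags; v \<in> frags; Q u; Q v\<rbrakk> \<Longrightarrow> Q (u - v)"
  shows "Q u"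
proof -
  have rel: "Q u" if "u \<in> tensor_relations (laurent_poly R) P (novikov_module \<epsilon> R)" for u
    using that assms(3-5) unfolding tensor_relations_def by auto
  have "Q u \<and> u \<in> frags"
    using assms(1) unfolding tensor_subgroup_def
  proof induction
    case one
    then show ?case
      using \<open>Q 0\<close> by simp
  next
    case (incl u)
    then show ?case
      using rel relations_subset by blast
  next
    case (inv u)
    then have "Q (0 - u)" "u \<in> frags"
      using rel relations_subset diff \<open>Q 0\<close> frags_zero by blast+
    then show ?case
      using frags_diff [OF frags_zero, of u] by (simp add: frags_def)
  next
    case (eng u v)
    then have "Q (u - (0 - v))"
      by (intro diff \<open>Q 0\<close>) simp_all
    then show ?case
      using eng.IH by simp
  qed
  then show ?thesis ..
qed

text \<open>The two additivity relations have zero series; only the balancing relation contributes a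
  nontrivial twisted difference.\<close>

lemma relators_twisted_diff:
  assumes "u \<in> relators"
  shows "series_of u \<in> twisted_diffs"
  using assms
proof (induction rule: relators_induct)
  case zero
  show ?case
    using twisted_diffs_zero by (simp add: series_of_zero [abs_def])
next
  case (add_left x x' b)
  have "series_of (frag_of (x \<oplus>\<^bsub>P\<^esub> x', b) - frag_of (x, b) - frag_of (x', b)) j = \<zero>\<^bsub>P\<^esub>" for j
    using add_left by (simp add: series_of_diff series_of_gen P.rsmult_add_left P.rsmult_closed R.laurent_const_closed
        novikov_series_closed P.M.add_minus_swap P.M.minus_self)
  then show ?case
    using twisted_diffs_zero by presburger
next
  case (add_right x b b')
  have "series_of (frag_of (x, \<lambda>n. b n \<oplus>\<^bsub>R\<^esub> b' n) - frag_of (x, b) - frag_of (x, b')) j = \<zero>\<^bsub>P\<^esub>" for j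
    using add_right abelian_group_hom.hom_add [OF const_hom]
    by (simp add: series_of_diff series_of_gen novikov_add_closed P.rsmult_closed R.laurent_const_closed
        novikov_series_closed P.M.add_minus_swap P.M.minus_self)
  then show ?case
    using twisted_diffs_zero by presburger
next
  case (balance x a b)
  then show ?case
    by (rule balance_twisted_diff)
next
  case (diff u v)
  then have "series_of (u - v) = (\<lambda>j. series_of u j \<oplus>\<^bsub>P\<^esub> \<ominus>\<^bsub>P\<^esub> series_of v j)"
    by (intro ext) (simp add: series_of_diff a_minus_def)
  then show ?case
    using twisted_diffs_add [OF diff.IH(1) twisted_diffs_inv [OF diff.IH(2)]] by simp
qed

text \<open>For the series of \<open>x \<otimes> a\<close>, the twisted difference is the series of
  the balancing relation with scalar \<open>z^(-\<epsilon>)\<close>. Additivity gives the general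
  case.\<close>

lemma twisted_diff_eq_relator:
  assumes "c \<in> mseries"
  obtains u where "u \<in> relators" "series_of u = twisted_diff c"
proof -
  have "\<exists>u\<in>relators. \<forall>j. series_of u j = twisted_diff c j"
    using assms
  proof induction
    case (gen x a)
    let ?t = "laurent_monom R (- \<epsilon>) \<one>\<^bsub>R\<^esub>"
    let ?ta = "?t \<otimes>\<^bsub>series_ring R (novikov_series \<epsilon> R)\<^esub> a"
    have x: "x \<in> carrier P" and t: "?t \<in> carrier (laurent_poly R)" and ac: "a j \<in> carrier R" for j
      using gen by (simp_all add: R.laurent_monom_closed novikov_series_closed)
    have "?ta = (\<lambda>n. a (n + \<epsilon>))"
      using gen(2) ac by (subst R.monom_mult_eq) (auto simp: novikov_series_closed)
    then have "series_of (frag_of (x \<triangleleft>\<^bsub>P\<^esub> ?t, a) - frag_of (x, ?ta)) j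
        = twisted_diff (\<lambda>j. x \<triangleleft>\<^bsub>restrict_scalars (laurent_const R) P\<^esub> a j) j" for j
      using x t ac gen(2) laurent_mult_closed [OF t gen(2)]
      by (simp add: series_of_diff series_of_gen P.rsmult_closed twisted_diff_def laurent_const_eq_monom
          R.laurent_monom_closed R.laurent_monom_mult flip: P.rsmult_assoc)
    then show ?case
      using relator_balance [OF x t gen(2)] by blast
  next
    case (add c c')
    then obtain u v where "u \<in> relators" "\<forall>j. series_of u j = twisted_diff c j"
      "v \<in> relators" "\<forall>j. series_of v j = twisted_diff c' j" by blast
    with add.hyps show ?case
      by (intro bexI [of _ "u + v"])
        (simp_all add: series_of_add relators_add relators_frags twisted_diff_add)
  qed
  then show thesis
    using that by blast
qed

end

section \<open>Free modules and their coordinates\<close>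

lemma free_right_module_simps [simp]:
  "carrier (free_right_module A I) = {v \<in> UNIV \<rightarrow> carrier A. finite {i. v i \<noteq> \<zero>\<^bsub>A\<^esub>} \<and> {i. v i \<noteq> \<zero>\<^bsub>A\<^esub>} \<subseteq> I}"
  "zero (free_right_module A I) = (\<lambda>i. \<zero>\<^bsub>A\<^esub>)"
  "add (free_right_module A I) = (\<lambda>v w i. v i \<oplus>\<^bsub>A\<^esub> w i)"
  "v \<triangleleft>\<^bsub>free_right_module A I\<^esub> a = (\<lambda>i. v i \<otimes>\<^bsub>A\<^esub> a)"
  by (simp_all add: free_right_module_def)

context ring
begin

lemma abelian_group_free_right_module: "abelian_group (free_right_module R I)"
proof (rule abelian_groupI; clarsimp)
  fix v w assume v: "v \<in> UNIV \<rightarrow> carrier R" "finite {i. v i \<noteq> \<zero>}" "{i. v i \<noteq> \<zero>} \<subseteq> I"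
    and w: "w \<in> UNIV \<rightarrow> carrier R" "finite {i. w i \<noteq> \<zero>}" "{i. w i \<noteq> \<zero>} \<subseteq> I"
  have "{i. v i \<oplus> w i \<noteq> \<zero>} \<subseteq> {i. v i \<noteq> \<zero>} \<union> {i. w i \<noteq> \<zero>}"
    by auto
  then have "finite {i. v i \<oplus> w i \<noteq> \<zero>} \<and> {i. v i \<oplus> w i \<noteq> \<zero>} \<subseteq> I"
    using v w by (meson finite_UnI finite_subset le_sup_iff order_trans)
  moreover have "(\<lambda>i. v i \<oplus> w i) \<in> UNIV \<rightarrow> carrier R"
    using v w by auto
  ultimately show "(\<lambda>i. v i \<oplus> w i) \<in> UNIV \<rightarrow> carrier R \<and> finite {i. v i \<oplus> w i \<noteq> \<zero>} \<and> {i. v i \<oplus> w i \<noteq> \<zero>} \<subseteq> I"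
    by blast
next
  fix v assume v: "v \<in> UNIV \<rightarrow> carrier R" "finite {i. v i \<noteq> \<zero>}" "{i. v i \<noteq> \<zero>} \<subseteq> I"
  have "(\<ominus> v i \<noteq> \<zero>) \<longleftrightarrow> (v i \<noteq> \<zero>)" for i
    using v by (metis PiE UNIV_I add.inv_eq_1_iff)
  moreover have "(\<lambda>i. \<ominus> v i) \<in> UNIV \<rightarrow> carrier R" "\<And>i. \<ominus> v i \<oplus> v i = \<zero>"
    using v by (auto simp: l_neg Pi_iff)
  ultimately show "\<exists>w. w \<in> UNIV \<rightarrow> carrier R \<and> finite {i. w i \<noteq> \<zero>} \<and> {i. w i \<noteq> \<zero>} \<subseteq> I \<and> (\<lambda>i. w i \<oplus> v i) = (\<lambda>i. \<zero>)"
    using v by (intro exI [of _ "\<lambda>i. \<ominus> v i"]) simp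
qed (auto simp: Pi_iff a_ac)

lemma free_eval_hom: "abelian_group_hom (free_right_module R I) R (\<lambda>v. v i)"
  by (rule additive_abelian_group_homI [OF abelian_group_free_right_module abelian_group_axioms]) auto

definition unit_vector :: "'i \<Rightarrow> 'i \<Rightarrow> 'a" where
  "unit_vector i = (\<lambda>k. if k = i then \<one> else \<zero>)"

lemma unit_vector_closed: "i \<in> I \<Longrightarrow> unit_vector i \<in> carrier (free_right_module R I)"
  by (auto simp: unit_vector_def intro: finite_subset [of _ "{i}"])

lemma unit_vector_smult_closed:
  assumes "i \<in> I" "a \<in> carrier R"
  shows "unit_vector i \<triangleleft>\<^bsub>free_right_module R I\<^esub> a \<in> carrier (free_right_module R I)"
proof -
  have "unit_vector i \<triangleleft>\<^bsub>free_right_module R I\<^esub> a = (\<lambda>k. if k = i then a else \<zero>)"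
    using assms by (auto simp: unit_vector_def)
  then show ?thesis
    using assms by (auto split: if_splits intro: finite_subset [of _ "{i}"])
qed

text \<open>\<open>F\<close> may exceed the support of \<open>v\<close>, so that one finite set can
  serve all module elements occurring in a formal sum.\<close>

lemma free_module_decomposition:
  assumes v: "v \<in> carrier (free_right_module R I)" and F: "finite F" "F \<subseteq> I" "{i. v i \<noteq> \<zero>} \<subseteq> F"
  shows "v = (\<Oplus>\<^bsub>free_right_module R I\<^esub>i\<in>F. unit_vector i \<triangleleft>\<^bsub>free_right_module R I\<^esub> v i)"
proof
  fix k
  have vc: "v i \<in> carrier R" for i
    using v by auto
  have "(\<lambda>i. unit_vector i \<triangleleft>\<^bsub>free_right_module R I\<^esub> v i) \<in> F \<rightarrow> carrier (free_right_module R I)"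
    using F vc by (blast intro: unit_vector_smult_closed)
  then have "(\<Oplus>\<^bsub>free_right_module R I\<^esub>i\<in>F. unit_vector i \<triangleleft>\<^bsub>free_right_module R I\<^esub> v i) k
      = (\<Oplus>i\<in>F. (unit_vector i \<triangleleft>\<^bsub>free_right_module R I\<^esub> v i) k)"
    by (rule abelian_group_hom.hom_finsum [OF free_eval_hom])
  also have "\<dots> = (\<Oplus>i\<in>F \<inter> {k}. v k)"
    using F vc by (intro add.finprod_mono_neutral_cong_right) (auto simp: unit_vector_def)
  also have "\<dots> = v k"
  proof (cases "k \<in> F")
    case False
    then have "v k = \<zero>" "F \<inter> {k} = {}"
      using F by auto
    then show ?thesis by simp
  qed (simp add: vc Pi_iff)
  finally show "v k = (\<Oplus>\<^bsub>free_right_module R I\<^esub>i\<in>F. unit_vector i \<triangleleft>\<^bsub>free_right_module R I\<^esub> v i) k" ..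
qed

end

section \<open>Injectivity of the series map for projective modules\<close>

context laurent_novikov
begin

text \<open>The additivity relation for \<open>0 + 0\<close> collapses to the negative of this
  generator.\<close>

lemma relator_zero_left:
  assumes "a \<in> novikov_series \<epsilon> R"
  shows "frag_of (\<zero>\<^bsub>P\<^esub>, a) \<in> relators"
  using relators_minus [OF relator_add_left [OF P.M.zero_closed P.M.zero_closed assms]] by simp

lemma relator_finsum_left:
  assumes "finite I" "x \<in> I \<rightarrow> carrier P" and a: "a \<in> novikov_series \<epsilon> R"
  shows "frag_of (\<Oplus>\<^bsub>P\<^esub>i\<in>I. x i, a) - (\<Sum>i\<in>I. frag_of (x i, a)) \<in> relators"
  using assms(1,2)
proof induction
  case (insert i I)
  then have x: "x i \<in> carrier P" "(\<Oplus>\<^bsub>P\<^esub>i\<in>I. x i) \<in> carrier P"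
    by (auto intro: P.M.finsum_closed)
  have "frag_of (x i \<oplus>\<^bsub>P\<^esub> (\<Oplus>\<^bsub>P\<^esub>i\<in>I. x i), a) - (frag_of (x i, a) + (\<Sum>i\<in>I. frag_of (x i, a)))
      = (frag_of (x i \<oplus>\<^bsub>P\<^esub> (\<Oplus>\<^bsub>P\<^esub>i\<in>I. x i), a) - frag_of (x i, a) - frag_of (\<Oplus>\<^bsub>P\<^esub>i\<in>I. x i, a))
        + (frag_of (\<Oplus>\<^bsub>P\<^esub>i\<in>I. x i, a) - (\<Sum>i\<in>I. frag_of (x i, a)))"
    by (simp add: algebra_simps)
  also have "\<dots> \<in> relators"
    using insert by (intro relators_add relator_add_left x a) auto
  finally show ?case
    using insert x by (simp add: P.M.finsum_insert)
qed (simp add: relator_zero_left a)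

lemma relator_diff_right:
  assumes x: "x \<in> carrier P" and a: "a \<in> novikov_series \<epsilon> R" and b: "b \<in> novikov_series \<epsilon> R"
  shows "frag_of (x, a \<ominus>\<^bsub>novikov_module \<epsilon> R\<^esub> b) - frag_of (x, a) + frag_of (x, b) \<in> relators"
proof -
  have ab: "a \<ominus>\<^bsub>novikov_module \<epsilon> R\<^esub> b \<in> novikov_series \<epsilon> R"
    using N.minus_closed [of a b] a b by simp
  have "(a \<ominus>\<^bsub>novikov_module \<epsilon> R\<^esub> b) \<oplus>\<^bsub>novikov_module \<epsilon> R\<^esub> b = a"
    using N.minus_eq_iff [of a b "a \<ominus>\<^bsub>novikov_module \<epsilon> R\<^esub> b"] a b ab by simp
  then show ?thesis
    using relators_minus [OF relator_add_right [OF x ab b]] by (simp add: algebra_simps)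
qed

lemma relator_zero_right:
  assumes "x \<in> carrier P"
  shows "frag_of (x, \<zero>\<^bsub>novikov_module \<epsilon> R\<^esub>) \<in> relators"
  using relators_minus [OF relator_add_right [OF assms, of "\<zero>\<^bsub>novikov_module \<epsilon> R\<^esub>" "\<zero>\<^bsub>novikov_module \<epsilon> R\<^esub>"]]
    N.zero_closed N.r_zero [OF N.zero_closed] by simp

lemma novikov_eval_hom: "abelian_group_hom (novikov_module \<epsilon> R) R (\<lambda>a. a n)"
  by (rule additive_abelian_group_homI [OF N.abelian_group_axioms R.abelian_group_axioms])
    (auto simp: novikov_series_closed)

text \<open>For projective \<open>P\<close>, an element of \<open>P \<otimes> N\<close> can be written in the coordinates of a free module
  containing \<open>P\<close>, and these coordinates depend only on the associated series.\<close>

lemma series_of_eq_zero_imp_relator: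
  assumes proj: "projective_module (laurent_poly R) P"
    and u: "u \<in> frags" and zero: "\<And>j. series_of u j = \<zero>\<^bsub>P\<^esub>"
  shows "u \<in> relators"
proof -
  let ?L = "laurent_poly R" and ?NR = "series_ring R (novikov_series \<epsilon> R)" and ?N = "novikov_module \<epsilon> R"
  obtain I :: "'b set" and s p where s: "s \<in> right_module_hom ?L P (free_right_module ?L I)"
    and p: "p \<in> right_module_hom ?L (free_right_module ?L I) P" and ps: "\<And>x. x \<in> carrier P \<Longrightarrow> p (s x) = x"
    using proj unfolding projective_module_def by blast
  interpret s: abelian_group_hom P "free_right_module ?L I" s
    using s by (intro right_module_hom_abelian_group_hom P.M.abelian_group_axioms P.A.abelian_group_free_right_module)
  interpret p: abelian_group_hom "free_right_module ?L I" P p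
    using p by (intro right_module_hom_abelian_group_hom P.M.abelian_group_axioms P.A.abelian_group_free_right_module)
  have sx: "s x i \<in> carrier ?L" "finite {i. s x i \<noteq> \<zero>\<^bsub>?L\<^esub>}" "{i. s x i \<noteq> \<zero>\<^bsub>?L\<^esub>} \<subseteq> I"
    if "x \<in> carrier P" for x i
    using s.hom_closed [OF that] by auto
  \<comment> \<open>On \<open>x \<otimes> a\<close> this is \<open>s(x)_i a\<close>, the coordinate
    with index \<open>i\<close> in the direct sum of copies of the Novikov ring obtained by
    tensoring the free module.\<close>
  define coord where "coord i = frag_lift (carrier P \<times> novikov_series \<epsilon> R) ?N (\<lambda>(x, a). s x i \<otimes>\<^bsub>?NR\<^esub> a)" for i
  have coord_fun: "(\<lambda>(x, a). s x i \<otimes>\<^bsub>?NR\<^esub> a) \<in> carrier P \<times> novikov_series \<epsilon> R \<rightarrow> carrier ?N" for i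
    using sx by (auto intro: laurent_mult_closed)
  note coord_closed = N.frag_lift_closed [OF coord_fun, folded coord_def]
    and coord_diff = N.frag_lift_diff [OF coord_fun, folded coord_def]
    and coord_zero = N.frag_lift_zero [OF coord_fun, folded coord_def]
    and coord_gen = N.frag_lift(2) [OF coord_fun, folded coord_def]
  let ?b = "\<lambda>i. p (P.A.unit_vector i)"
  have b: "?b i \<in> carrier P" if "i \<in> I" for i
    using p.hom_closed [OF P.A.unit_vector_closed [OF that]] .

  have fin: "finite (fst ` Poly_Mapping.keys u)" "fst ` Poly_Mapping.keys u \<subseteq> carrier P"
    using u by (auto simp: frags_def)
  define F where "F = (\<Union>x\<in>fst ` Poly_Mapping.keys u. {i. s x i \<noteq> \<zero>\<^bsub>?L\<^esub>})"
  have F: "finite F" "F \<subseteq> I"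
    unfolding F_def using fin sx(2,3) by (blast intro: finite_UN_I)+
  \<comment> \<open>Restricting the generators to those with coordinates supported in
    \<open>F\<close> keeps \<open>F\<close> fixed while \<open>u\<close> varies in the
    induction.\<close>
  let ?S = "{(x, a). x \<in> carrier P \<and> a \<in> novikov_series \<epsilon> R \<and> {i. s x i \<noteq> \<zero>\<^bsub>?L\<^esub>} \<subseteq> F}"
  have "Poly_Mapping.keys u \<subseteq> ?S"
    using u by (force simp: F_def frags_def)
  \<comment> \<open>With \<open>b_i = p(e_i)\<close> for the unit vectors \<open>e_i\<close>, one
    has \<open>x = p(s x)\<close>, which is the sum of the \<open>b_i s(x)_i\<close>. Hence
    \<open>x \<otimes> a\<close> is the sum of the \<open>b_i \<otimes> s(x)_i a\<close>, and
    \<open>u\<close> is recovered from its coordinates modulo relators.\<close>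
  then have "u - (\<Sum>i\<in>F. frag_of (?b i, coord i u)) \<in> relators \<and> u \<in> frags"
  proof (induction rule: free_Abelian_group_induct [consumes 1, case_names zero diff gen])
    case zero
    have "(\<Sum>i\<in>F. frag_of (?b i, \<zero>\<^bsub>?N\<^esub>)) \<in> relators"
      using F b by (intro relators_sum relator_zero_right) auto
    then show ?case
      using relators_minus by (simp add: coord_zero)
  next
    case (diff u v)
    have uv: "coord i u \<in> novikov_series \<epsilon> R" "coord i v \<in> novikov_series \<epsilon> R"
      "coord i (u - v) = coord i u \<ominus>\<^bsub>?N\<^esub> coord i v" for i
      using diff coord_closed coord_diff by (auto simp: frags_def)
    have "(\<Sum>i\<in>F. frag_of (?b i, coord i (u - v)) - frag_of (?b i, coord i u) + frag_of (?b i, coord i v)) \<in> relators"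
      unfolding uv(3) using F b uv by (intro relators_sum relator_diff_right) auto
    with diff have "(u - (\<Sum>i\<in>F. frag_of (?b i, coord i u))) - (v - (\<Sum>i\<in>F. frag_of (?b i, coord i v)))
        - (\<Sum>i\<in>F. frag_of (?b i, coord i (u - v)) - frag_of (?b i, coord i u) + frag_of (?b i, coord i v)) \<in> relators"
      by - (rule relators_diff [OF relators_diff], auto)
    with diff show ?case
      by (simp add: sum.distrib sum_subtractf algebra_simps)
  next
    case (gen xa)
    then obtain x a where xa: "xa = (x, a)" and x: "x \<in> carrier P" and a: "a \<in> novikov_series \<epsilon> R"
      and sxF: "{i. s x i \<noteq> \<zero>\<^bsub>?L\<^esub>} \<subseteq> F" by auto
    let ?y = "\<lambda>i. ?b i \<triangleleft>\<^bsub>P\<^esub> s x i"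
    have y: "?y \<in> F \<rightarrow> carrier P"
      using F(2) by (auto intro!: P.rsmult_closed b sx(1) [OF x])
    have "x = p (s x)"
      using ps x by simp
    also have "s x = (\<Oplus>\<^bsub>free_right_module ?L I\<^esub>i\<in>F. P.A.unit_vector i \<triangleleft>\<^bsub>free_right_module ?L I\<^esub> s x i)"
      using P.A.free_module_decomposition [OF s.hom_closed [OF x] F sxF] .
    also have "p \<dots> = (\<Oplus>\<^bsub>P\<^esub>i\<in>F. p (P.A.unit_vector i \<triangleleft>\<^bsub>free_right_module ?L I\<^esub> s x i))"
      using F(2) sx(1) [OF x] by (intro p.hom_finsum) (blast intro: P.A.unit_vector_smult_closed)
    also have "\<dots> = (\<Oplus>\<^bsub>P\<^esub>i\<in>F. ?y i)"
      using y F(2) right_module_homD(3) [OF p P.A.unit_vector_closed sx(1) [OF x]]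
      by (intro P.M.finsum_cong') (auto simp del: free_right_module_simps)
    finally have x_eq: "x = (\<Oplus>\<^bsub>P\<^esub>i\<in>F. ?y i)" .
    have "frag_of (\<Oplus>\<^bsub>P\<^esub>i\<in>F. ?y i, a) - (\<Sum>i\<in>F. frag_of (?y i, a)) \<in> relators"
      by (rule relator_finsum_left [OF F(1) y a])
    moreover have "(\<Sum>i\<in>F. frag_of (?y i, a) - frag_of (?b i, s x i \<otimes>\<^bsub>?NR\<^esub> a)) \<in> relators"
      using F(2) by (intro relators_sum relator_balance b sx(1) [OF x] a) auto
    ultimately have "frag_of (x, a) - (\<Sum>i\<in>F. frag_of (?b i, s x i \<otimes>\<^bsub>?NR\<^esub> a)) \<in> relators"
      using relators_add by (fastforce simp: sum_subtractf simp flip: x_eq)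
    then show ?case
      using x a by (simp add: xa coord_gen)
  qed
  moreover have "coord i u = \<zero>\<^bsub>?N\<^esub>" if "i \<in> I" for i
  proof
    fix m
    \<comment> \<open>The finitely many exponents occurring in the coordinate \<open>i\<close> of
      the elements in \<open>u\<close>; it plays for exponents the part that \<open>F\<close> plays
      for basis indices.\<close>
    define \<Lambda> where "\<Lambda> = (\<Union>x\<in>fst ` Poly_Mapping.keys u. {l. s x i l \<noteq> \<zero>\<^bsub>R\<^esub>})"
    have \<Lambda>: "finite \<Lambda>"
      using fin sx(1) by (auto simp: \<Lambda>_def laurent_poly_def)
    have hom: "abelian_group_hom P R (\<lambda>x. s x i l)" for l
      by (rule additive_abelian_group_homI [OF P.M.abelian_group_axioms R.abelian_group_axioms])
        (use sx(1) s.hom_add in \<open>auto simp: laurent_poly_def Pi_iff\<close>)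
    let ?S = "{(x, a). x \<in> carrier P \<and> a \<in> novikov_series \<epsilon> R \<and> {l. s x i l \<noteq> \<zero>\<^bsub>R\<^esub>} \<subseteq> \<Lambda>}"
    have "Poly_Mapping.keys u \<subseteq> ?S"
      using u by (force simp: \<Lambda>_def frags_def)
    \<comment> \<open>Linearity of \<open>s\<close> gives
      \<open>s(x a_j)_(i,l) = s(x)_(i,l) a_j\<close>, so the Cauchy product for
      \<open>s(x)_i a\<close> can be computed from the series of \<open>u\<close> alone. A zero
      series therefore forces zero coordinates.\<close>
    then have "coord i u m = (\<Oplus>\<^bsub>R\<^esub>l\<in>\<Lambda>. s (series_of u (m - l)) i l) \<and> u \<in> frags"
    proof (induction rule: free_Abelian_group_induct [consumes 1, case_names zero diff gen])
      case zero
      have "(\<Oplus>\<^bsub>R\<^esub>l\<in>\<Lambda>. s (series_of 0 (m - l)) i l) = \<zero>\<^bsub>R\<^esub>"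
        using abelian_group_hom.hom_zero [OF hom] by (intro R.add.finprod_one_eqI) (simp add: series_of_zero)
      then show ?case
        by (simp add: coord_zero)
    next
      case (diff u v)
      have uv: "coord i (u - v) = coord i u \<ominus>\<^bsub>?N\<^esub> coord i v" "coord i u \<in> carrier ?N" "coord i v \<in> carrier ?N"
        using diff coord_closed coord_diff by (auto simp: frags_def)
      have "coord i (u - v) m = coord i u m \<ominus>\<^bsub>R\<^esub> coord i v m"
        unfolding uv(1) by (rule abelian_group_hom.hom_minus [OF novikov_eval_hom uv(2,3)])
      also have "\<dots> = (\<Oplus>\<^bsub>R\<^esub>l\<in>\<Lambda>. s (series_of u (m - l)) i l \<ominus>\<^bsub>R\<^esub> s (series_of v (m - l)) i l)"
        using diff abelian_group_hom.hom_closed [OF hom]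
        by (subst R.finsum_minus) (auto simp: series_of_closed)
      also have "\<dots> = (\<Oplus>\<^bsub>R\<^esub>l\<in>\<Lambda>. s (series_of (u - v) (m - l)) i l)"
        using diff abelian_group_hom.hom_minus [OF hom]
        by (simp add: series_of_diff series_of_closed)
      finally show ?case
        using diff by simp
    next
      case (gen xa)
      then obtain x a where xa: "xa = (x, a)" and x: "x \<in> carrier P" and a: "a \<in> novikov_series \<epsilon> R"
        and \<Lambda>x: "{l. s x i l \<noteq> \<zero>\<^bsub>R\<^esub>} \<subseteq> \<Lambda>" by auto
      have ac: "a j \<in> carrier R" for j
        using a by (rule novikov_series_closed)
      have sxi: "s x i \<in> UNIV \<rightarrow> carrier R"
        using sx(1) [OF x] by (rule R.laurent_series_closed)
      have "coord i (frag_of xa) m = (\<Oplus>\<^bsub>R\<^esub>l\<in>\<Lambda>. s x i l \<otimes>\<^bsub>R\<^esub> a (m - l))"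
        using x a ac \<Lambda> \<Lambda>x sxi by (simp add: xa coord_gen) (intro R.series_mult_eq, auto)
      also have "\<dots> = (\<Oplus>\<^bsub>R\<^esub>l\<in>\<Lambda>. s (series_of (frag_of xa) (m - l)) i l)"
      proof -
        have "s (x \<triangleleft>\<^bsub>P\<^esub> laurent_const R r) i l = s x i l \<otimes>\<^bsub>R\<^esub> r" if "r \<in> carrier R" for r l
          using right_module_homD(3) [OF s x R.laurent_const_closed [OF that]] R.mult_const_eq [OF that sxi]
          by (simp add: laurent_poly_def)
        then show ?thesis
          by (simp add: xa series_of_gen x a ac)
      qed
      finally show ?case
        by (simp add: xa x a)
    qed
    then show "coord i u m = \<zero>\<^bsub>?N\<^esub> m"
      using abelian_group_hom.hom_zero [OF hom] by (simp add: zero)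
  qed
  then have "(\<Sum>i\<in>F. frag_of (?b i, coord i u)) \<in> relators"
    using F b by (intro relators_sum) (auto simp: relator_zero_right simp del: left_regular_module_simps series_ring_simps)
  ultimately show ?thesis
    using relators_add by fastforce
qed

text \<open>This identifies the tensor product with the cokernel of \<open>twisted_diff\<close> on
  \<open>mseries\<close>. If the series of \<open>u\<close> is a twisted difference, subtracting a
  relator with the same series leaves a formal sum with zero series, which is a relator by
  projectivity.\<close>

proposition relator_iff_twisted_diff:
  assumes "projective_module (laurent_poly R) P" and u: "u \<in> frags"
  shows "u \<in> relators \<longleftrightarrow> series_of u \<in> twisted_diffs"
proof
  assume "series_of u \<in> twisted_diffs"
  then obtain c where "c \<in> mseries" "series_of u = twisted_diff c"
    by blast
  then obtain v where v: "v \<in> relators" "series_of v = series_of u"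
    using twisted_diff_eq_relator by metis
  have "u - v \<in> relators"
  proof (rule series_of_eq_zero_imp_relator [OF assms(1)])
    show "series_of (u - v) j = \<zero>\<^bsub>P\<^esub>" for j
      using u v by (simp add: series_of_diff relators_frags series_of_closed P.M.minus_self)
  qed (simp add: u v relators_frags)
  then show "u \<in> relators"
    using relators_add [OF _ v(1)] by fastforce
qed (rule relators_twisted_diff)

end

section \<open>Acyclicity of the Novikov complexes\<close>

text \<open>Substituting the kernel for the image makes the cohomology a group modulo itself, whose
  only coset is the whole group.\<close>

lemma trivial_cohomologyI:
  assumes "group (obj K n)" "group (obj K (n + 1))" "diff K n \<in> hom (obj K n) (obj K (n + 1))"
    and im: "kernel (obj K n) (obj K (n + 1)) (diff K n) = diff K (n - 1) ` carrier (obj K (n - 1))"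
  shows "trivial_group (cohomology K n)"
proof -
  interpret d: group_hom "obj K n" "obj K (n + 1)" "diff K n"
    using assms(1-3) by (simp add: group_hom_def group_hom_axioms_def)
  let ?Z = "kernel (obj K n) (obj K (n + 1)) (diff K n)"
  interpret Z: group "(obj K n)\<lparr>carrier := ?Z\<rparr>"
    by (rule subgroup.subgroup_is_group [OF d.subgroup_kernel d.G.is_group])
  have "?Z \<lhd> (obj K n)\<lparr>carrier := ?Z\<rparr>"
    using Z.normal_self by simp
  then have "group (cohomology K n)"
    unfolding cohomology_def im [symmetric] by (rule normal.factorgroup_is_group)
  moreover have "carrier (cohomology K n) = {?Z}"
    using Z.coset_join2 [OF _ Z.subgroup_self] Z.one_closed
    unfolding cohomology_def im [symmetric] FactGroup_def RCOSETS_def by auto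
  ultimately show ?thesis
    by (simp add: trivial_group_def cohomology_def FactGroup_def flip: im)
qed

section \<open>The tensor product as a group of cosets\<close>

context laurent_novikov
begin

abbreviation "G \<equiv> free_Abelian_group (carrier P \<times> novikov_series \<epsilon> R)"

abbreviation "tensor \<equiv> tensor_product (laurent_poly R) P (novikov_module \<epsilon> R)"

definition coset :: "('b \<times> (int \<Rightarrow> 'a) \<Rightarrow>\<^sub>0 int) \<Rightarrow> ('b \<times> (int \<Rightarrow> 'a) \<Rightarrow>\<^sub>0 int) set"
  where "coset u = relators #>\<^bsub>G\<^esub> u"

lemma carrier_G: "carrier G = frags"
  by (auto simp: frags_def)

lemma tensor_eq: "tensor = G Mod relators"
  by (simp add: tensor_product_def)

lemma relators_normal: "relators \<lhd> G"
  using relators_subgroup by (rule comm_group.subgroup_imp_normal [OF abelian_free_Abelian_group])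

lemma group_tensor: "group tensor"
  unfolding tensor_eq by (rule normal.factorgroup_is_group [OF relators_normal])

lemma coset_eq: "coset u = (\<lambda>h. h + u) ` relators"
  by (auto simp: coset_def r_coset_def)

lemma coset_eq_iff:
  assumes "u \<in> frags" "v \<in> frags"
  shows "coset u = coset v \<longleftrightarrow> u - v \<in> relators"
proof
  assume "coset u = coset v"
  moreover have "u \<in> coset u"
    unfolding coset_eq using relators_zero by force
  ultimately show "u - v \<in> relators"
    unfolding coset_eq by auto
next
  assume uv: "u - v \<in> relators"
  have "h + u \<in> coset v" if "h \<in> relators" for h
    unfolding coset_eq using relators_add [OF that uv] by (intro image_eqI [where x = "h + (u - v)"]) auto
  moreover have "h + v \<in> coset u" if "h \<in> relators" for h
    unfolding coset_eq using relators_diff [OF that uv] by (intro image_eqI [where x = "h - (u - v)"]) auto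
  ultimately show "coset u = coset v"
    unfolding coset_eq by blast
qed

lemma carrier_tensor: "carrier tensor = coset ` frags"
  unfolding tensor_eq FactGroup_def RCOSETS_def carrier_G coset_def by auto

lemma one_tensor: "\<one>\<^bsub>tensor\<^esub> = coset 0"
  by (simp add: tensor_eq FactGroup_def coset_eq)

lemma mult_tensor:
  assumes "u \<in> frags" "v \<in> frags"
  shows "coset u \<otimes>\<^bsub>tensor\<^esub> coset v = coset (u + v)"
  using normal.rcos_sum [OF relators_normal, of u v] assms unfolding carrier_G
  by (simp add: tensor_eq FactGroup_def coset_def)

lemma frags_induct [consumes 1, case_names zero gen diff]:
  assumes "u \<in> frags" and "Q 0"
    and "\<And>x a. \<lbrakk>x \<in> carrier P; a \<in> novikov_series \<epsilon> R\<rbrakk> \<Longrightarrow> Q (frag_of (x, a))"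
    and "\<And>u v. \<lbrakk>u \<in> frags; v \<in> frags; Q u; Q v\<rbrakk> \<Longrightarrow> Q (u - v)"
  shows "Q u"
proof -
  have "Poly_Mapping.keys u \<subseteq> carrier P \<times> novikov_series \<epsilon> R"
    using assms(1) by (simp add: frags_def)
  then show ?thesis
    by (induction rule: free_Abelian_group_induct [consumes 1])
      (use assms(2-4) in \<open>auto simp: frags_def\<close>)
qed

end

section \<open>Maps induced by module homomorphisms\<close>

locale laurent_novikov_hom = dom: laurent_novikov R P \<epsilon> + cod: laurent_novikov R P' \<epsilon>
  for R :: "('a, 'e) ring_scheme" and P P' :: "(int \<Rightarrow> 'a, 'b) right_module" and \<epsilon> +
  fixes d :: "'b \<Rightarrow> 'b"
  assumes d: "d \<in> right_module_hom (laurent_poly R) P P'"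
begin

definition frag_map :: "('b \<times> (int \<Rightarrow> 'a) \<Rightarrow>\<^sub>0 int) \<Rightarrow> 'b \<times> (int \<Rightarrow> 'a) \<Rightarrow>\<^sub>0 int"
  where "frag_map = frag_extend (\<lambda>(x, a). frag_of (d x, a))"

lemma frag_map_simps [simp]:
  "frag_map 0 = 0" "frag_map (frag_of (x, a)) = frag_of (d x, a)"
  "frag_map (u + v) = frag_map u + frag_map v" "frag_map (u - v) = frag_map u - frag_map v"
  by (simp_all add: frag_map_def frag_extend_add frag_extend_diff)

lemma frag_map_frags: "u \<in> dom.frags \<Longrightarrow> frag_map u \<in> cod.frags"
  by (induction rule: dom.frags_induct) (use right_module_homD(1) [OF d] in auto)

lemma frag_map_relators: "u \<in> dom.relators \<Longrightarrow> frag_map u \<in> cod.relators"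
proof (induction rule: dom.relators_induct)
  case (add_left x x' b)
  then show ?case
    using right_module_homD [OF d] by (simp add: cod.relator_add_left)
next
  case (add_right x b b')
  then show ?case
    using right_module_homD [OF d] cod.relator_add_right by simp
next
  case (balance x a b)
  then show ?case
    using right_module_homD [OF d] by (simp add: cod.relator_balance)
qed (simp_all add: cod.relators_zero cod.relators_diff)

interpretation d: abelian_group_hom P P' d
  by (rule right_module_hom_abelian_group_hom [OF dom.P.M.abelian_group_axioms cod.P.M.abelian_group_axioms d])

text \<open>\<open>d\<close> is linear over the Laurent polynomials, so it commutes with the
  constants through which \<open>series_of\<close> is defined.\<close>

lemma series_of_frag_map: "u \<in> dom.frags \<Longrightarrow> cod.series_of (frag_map u) j = d (dom.series_of u j)"
proof (induction rule: dom.frags_induct)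
  case zero
  then show ?case
    by (simp add: dom.series_of_zero cod.series_of_zero)
next
  case (gen x a)
  then show ?case
    using right_module_homD [OF d]
    by (simp add: dom.series_of_gen cod.series_of_gen dom.R.laurent_const_closed novikov_series_closed)
next
  case (diff u v)
  then show ?case
    by (simp add: frag_map_frags dom.series_of_diff cod.series_of_diff dom.series_of_closed d.hom_minus)
qed

abbreviation "dmap \<equiv> tensor_map (laurent_poly R) P' (novikov_module \<epsilon> R) d"

text \<open>\<open>the_elem\<close> in \<open>tensor_map\<close> is meaningful only on a singleton.
  The image is one because relators go to relators and a coset is nonempty.\<close>

lemma tensor_map_coset:
  assumes u: "u \<in> dom.frags"
  shows "dmap (dom.coset u) = cod.coset (frag_map u)"
proof -
  have "cod.coset (frag_map (h + u)) = cod.coset (frag_map u)" if "h \<in> dom.relators" for h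
    using u dom.relators_frags [OF that] frag_map_relators [OF that]
    by (subst cod.coset_eq_iff) (simp_all add: frag_map_frags)
  then have "(\<lambda>v. cod.coset (frag_map v)) ` dom.coset u = {cod.coset (frag_map u)}"
    unfolding dom.coset_eq image_image using dom.relators_zero by blast
  then show ?thesis
    by (simp add: tensor_map_def frag_map_def cod.coset_def)
qed

lemma tensor_map_hom: "dmap \<in> hom dom.tensor cod.tensor"
proof (rule homI)
  fix X assume "X \<in> carrier dom.tensor"
  then show "dmap X \<in> carrier cod.tensor"
    unfolding dom.carrier_tensor cod.carrier_tensor
    using tensor_map_coset frag_map_frags by auto
next
  fix X Y assume "X \<in> carrier dom.tensor" "Y \<in> carrier dom.tensor"
  then obtain u v where "u \<in> dom.frags" "X = dom.coset u" "v \<in> dom.frags" "Y = dom.coset v"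
    unfolding dom.carrier_tensor by blast
  then show "dmap (X \<otimes>\<^bsub>dom.tensor\<^esub> Y) = dmap X \<otimes>\<^bsub>cod.tensor\<^esub> dmap Y"
    by (simp add: dom.mult_tensor tensor_map_coset cod.mult_tensor frag_map_frags)
qed

lemma tensor_map_coset_eq_one_iff:
  assumes "u \<in> dom.frags"
  shows "dmap (dom.coset u) = \<one>\<^bsub>cod.tensor\<^esub> \<longleftrightarrow> frag_map u \<in> cod.relators"
  using cod.coset_eq_iff [of "frag_map u" 0]
  by (simp add: tensor_map_coset assms cod.one_tensor frag_map_frags)

end

text \<open>Together with \<open>mseries_eq_series_of\<close>, this shows that
  \<open>mseries\<close> is exactly the image of \<open>series_of\<close>, so elements can be moved
  between formal sums and series.\<close>

lemma (in laurent_novikov) series_of_mseries: "u \<in> frags \<Longrightarrow> series_of u \<in> mseries"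
proof (induction rule: frags_induct)
  case zero
  then show ?case
    using mseries_ops(3) by (simp add: series_of_zero [abs_def])
next
  case (gen x a)
  then show ?case
    using mseries_gen [OF gen] series_of_gen [OF gen] by presburger
next
  case (diff u v)
  then have "series_of (u - v) = (\<lambda>j. series_of u j \<oplus>\<^bsub>P\<^esub> \<ominus>\<^bsub>P\<^esub> series_of v j)"
    by (intro ext) (simp add: series_of_diff a_minus_def)
  then show ?case
    using mseries_ops(1) [OF diff.IH(1) mseries_ops(2) [OF diff.IH(2)]] by simp
qed

lemma (in laurent_novikov) mseries_eq_series_of:
  assumes "c \<in> mseries"
  obtains u where "u \<in> frags" "\<And>j. series_of u j = c j"
proof -
  have "\<exists>u\<in>frags. \<forall>j. series_of u j = c j"
    using assms
  proof induction
    case (gen x a)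
    then show ?case
      by (intro bexI [of _ "frag_of (x, a)"]) (simp_all add: series_of_gen)
  next
    case (add c c')
    then obtain u v where "u \<in> frags" "\<forall>j. series_of u j = c j" "v \<in> frags" "\<forall>j. series_of v j = c' j"
      by blast
    then show ?case
      by (intro bexI [of _ "u + v"]) (simp_all add: series_of_add)
  qed
  then show thesis
    using that by blast
qed

section \<open>Restriction of the complex to \<open>R\<close> and the conclusion\<close>

lemma restrict_scalars_hom:
  assumes "f \<in> right_module_hom A M N" "\<And>r. r \<in> carrier R \<Longrightarrow> \<phi> r \<in> carrier A"
  shows "f \<in> right_module_hom R (restrict_scalars \<phi> M) (restrict_scalars \<phi> N)"
  using assms by (auto simp: right_module_hom_def)

lemma restrict_scalars_complex_simps [simp]:
  "obj (restrict_scalars_complex \<phi> C) n = restrict_scalars \<phi> (obj C n)"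
  "diff (restrict_scalars_complex \<phi> C) = diff C"
  by (simp_all add: restrict_scalars_complex_def)

lemma (in ring) restrict_laurent_complex:
  assumes "cochain_complex (laurent_poly R) C"
  shows "cochain_complex R (restrict_scalars_complex (laurent_const R) C)"
  using assms unfolding cochain_complex_def restrict_scalars_complex_simps restrict_scalars_simps
  by (auto intro!: restrict_laurent_const restrict_scalars_hom laurent_const_closed)

text \<open>Both Novikov rings are treated at once. Passing from formal sums to series,
  \<open>relator_iff_twisted_diff\<close> translates acyclicity of the tensor complex into
  \<open>mapping_torus_exact\<close>.\<close>

lemma acyclic_novikov_complex:
  fixes R :: "('a, 'e) ring_scheme" and C :: "(int \<Rightarrow> 'a, 'b) module_cochain"
    and B :: "('a, 'c) module_cochain"
  assumes R: "ring R" and \<epsilon>: "\<epsilon> = 1 \<or> \<epsilon> = -1"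
    and C: "cochain_complex (laurent_poly R) C" and proj: "\<And>n. projective_module (laurent_poly R) (obj C n)"
    and B: "cochain_complex R B" and fg: "\<And>n. finitely_generated_module R (obj B n)"
    and he: "homotopy_equivalent R (restrict_scalars_complex (laurent_const R) C) B"
  shows "acyclic_complex (tensor_complex (laurent_poly R) C (novikov_module \<epsilon> R))"
  unfolding acyclic_complex_def
proof
  fix n
  let ?C = "restrict_scalars_complex (laurent_const R) C" and ?K = "tensor_complex (laurent_poly R) C (novikov_module \<epsilon> R)"
  interpret R: ring R by (rule R)
  have mod: "right_module (laurent_poly R) (obj C n)" for n
    using C by (simp add: cochain_complex_def)
  have d: "diff C n \<in> right_module_hom (laurent_poly R) (obj C n) (obj C (n + 1))" for n
    using C by (simp add: cochain_complex_def)
  have d': "diff C (n - 1) \<in> right_module_hom (laurent_poly R) (obj C (n - 1)) (obj C n)" for n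
    using d [of "n - 1"] by simp
  have dd: "diff C n (diff C (n - 1) x) = \<zero>\<^bsub>obj C (n + 1)\<^esub>" if "x \<in> carrier (obj C (n - 1))" for n x
    using C that unfolding cochain_complex_def by (metis diff_add_cancel)
  interpret M: laurent_novikov R "obj C n" \<epsilon> for n
    by (intro laurent_novikov.intro laurent_novikov_axioms.intro R mod \<epsilon>)
  interpret d: laurent_novikov_hom R "obj C n" "obj C (n + 1)" \<epsilon> "diff C n" for n
    by (intro laurent_novikov_hom.intro laurent_novikov_hom_axioms.intro M.laurent_novikov_axioms d)
  interpret d': laurent_novikov_hom R "obj C (n - 1)" "obj C n" \<epsilon> "diff C (n - 1)" for n
    by (intro laurent_novikov_hom.intro laurent_novikov_hom_axioms.intro M.laurent_novikov_axioms d')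
  define t where "t n x = x \<triangleleft>\<^bsub>obj C n\<^esub> laurent_monom R (- \<epsilon>) \<one>\<^bsub>R\<^esub>" for n x
  obtain f g h where f: "cochain_map R ?C B f" and g: "cochain_map R B ?C g"
    and h: "\<forall>n. h n \<in> right_module_hom R (obj ?C n) (obj ?C (n - 1))"
    and homotopy: "\<forall>n. \<forall>x\<in>carrier (obj ?C n). g n (f n x) \<ominus>\<^bsub>obj ?C n\<^esub> x
      = diff ?C (n - 1) (h n x) \<oplus>\<^bsub>obj ?C n\<^esub> h (n + 1) (diff ?C n x)"
    using he unfolding homotopy_equivalent_def cochain_homotopic_def by blast
  \<comment> \<open>Multiplication by \<open>z^(-\<epsilon>)\<close> commutes with the differentials
    because these are linear over the Laurent polynomials.\<close>
  have "cochain_map R ?C ?C t"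
    unfolding cochain_map_def t_def
    using M.monom_hom right_module_homD(3) [OF d] by (simp add: R.laurent_monom_closed)
  then interpret T: complex_endomorphism R ?C B t f g h
    using f g h homotopy fg R.restrict_laurent_complex [OF C] B
    by (intro complex_endomorphism.intro) blast+
  have "kernel (M.tensor n) (M.tensor (n + 1)) (d.dmap n) = d'.dmap n ` carrier (M.tensor (n - 1))"
  proof (intro equalityI subsetI)
    fix X assume "X \<in> d'.dmap n ` carrier (M.tensor (n - 1))"
    then obtain w where w: "w \<in> M.frags (n - 1)" and X: "X = M.coset n (d'.frag_map n w)"
      unfolding M.carrier_tensor using d'.tensor_map_coset by auto
    \<comment> \<open>The series of this formal sum is zero since the differential squares to zero,
      and projectivity turns zero series into relators.\<close>
    have "d.frag_map n (d'.frag_map n w) \<in> M.relators (n + 1)"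
      using M.series_of_eq_zero_imp_relator [OF proj, of "d.frag_map n (d'.frag_map n w)" "n + 1"] w
      by (simp add: d.frag_map_frags d'.frag_map_frags d.series_of_frag_map d'.series_of_frag_map dd M.series_of_closed)
    then show "X \<in> kernel (M.tensor n) (M.tensor (n + 1)) (d.dmap n)"
      using w by (simp add: kernel_def X M.carrier_tensor d'.frag_map_frags d.tensor_map_coset_eq_one_iff)
  next
    fix X assume "X \<in> kernel (M.tensor n) (M.tensor (n + 1)) (d.dmap n)"
    then obtain u where u: "u \<in> M.frags n" "X = M.coset n u" and du: "d.frag_map n u \<in> M.relators (n + 1)"
      by (auto simp: kernel_def M.carrier_tensor d.tensor_map_coset_eq_one_iff)
    \<comment> \<open>A cocycle in the tensor complex has a differential that is a relator, so the
      series of that differential is the twisted difference of some \<open>y\<close>, as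
      \<open>mapping_torus_exact\<close> requires.\<close>
    obtain y where y: "y \<in> M.mseries (n + 1)" "M.series_of (n + 1) (d.frag_map n u) = M.twisted_diff (n + 1) y"
      using M.relators_twisted_diff [OF du] by blast
    have "diff ?C n (M.series_of n u j) = t (n + 1) (y j) \<ominus>\<^bsub>obj ?C (n + 1)\<^esub> y (j + \<epsilon>)" for j
      using y(2) d.series_of_frag_map [OF u(1), of j] by (simp add: M.twisted_diff_def t_def a_minus_def)
    then obtain c v where c: "c \<in> M.mseries (n - 1)" and v: "v \<in> M.mseries n"
      and eq: "\<And>j. M.series_of n u j = diff C (n - 1) (c j) \<oplus>\<^bsub>obj C n\<^esub> M.twisted_diff n v j"
      using T.mapping_torus_exact [OF \<epsilon>, of "M.series_of n u" n y] M.series_of_mseries [OF u(1)] y(1)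
      by (auto simp: M.twisted_diff_def t_def a_minus_def)
    \<comment> \<open>Lifting \<open>c\<close> to a formal sum \<open>w\<close> makes the series of
      \<open>u\<close> minus the differential of \<open>w\<close> a twisted difference; hence
      \<open>u\<close> and that differential have the same coset.\<close>
    obtain w where w: "w \<in> M.frags (n - 1)" and cw: "\<And>j. M.series_of (n - 1) w j = c j"
      using M.mseries_eq_series_of [OF c] by blast
    have "M.series_of n (u - d'.frag_map n w) = M.twisted_diff n v"
    proof
      fix j
      have cv: "diff C (n - 1) (c j) \<in> carrier (obj C n)" "M.twisted_diff n v j \<in> carrier (obj C n)"
        using M.mseries_closed [OF c] right_module_homD(1) [OF d'] M.twisted_diffs_closed v by blast+
      have "M.series_of n (u - d'.frag_map n w) j
          = (diff C (n - 1) (c j) \<oplus>\<^bsub>obj C n\<^esub> M.twisted_diff n v j) \<ominus>\<^bsub>obj C n\<^esub> diff C (n - 1) (c j)"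
        using u(1) w cw by (simp add: M.series_of_diff d'.frag_map_frags d'.series_of_frag_map flip: eq)
      also have "\<dots> = M.twisted_diff n v j"
        using cv M.P.M.add_minus_swap M.P.M.minus_self by simp
      finally show "M.series_of n (u - d'.frag_map n w) j = M.twisted_diff n v j" .
    qed
    then have "u - d'.frag_map n w \<in> M.relators n"
      using M.relator_iff_twisted_diff [OF proj] u w v by (simp add: d'.frag_map_frags)
    then have "X = d'.dmap n (M.coset (n - 1) w)"
      using u w by (simp add: d'.tensor_map_coset M.coset_eq_iff d'.frag_map_frags)
    then show "X \<in> d'.dmap n ` carrier (M.tensor (n - 1))"
      using w by (simp add: M.carrier_tensor)
  qed
  then show "trivial_group (cohomology ?K n)"
    using M.group_tensor d.tensor_map_hom
    by (intro trivial_cohomologyI) (simp_all add: tensor_complex_def)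
qed

theorem corollary2p7:
  fixes R :: "('a, 'e) ring_scheme"
    and C :: "(int \<Rightarrow> 'a, 'b) module_cochain"
    and B :: "('a, 'c) module_cochain"
  assumes "ring R"
    and "cochain_complex (laurent_poly R) C"
    and "bounded_above_complex C"
    and "\<forall>n. projective_module (laurent_poly R) (obj C n)"
    and "cochain_complex R B"
    and "bounded_complex B"
    and "\<forall>n. projective_module R (obj B n) \<and> finitely_generated_module R (obj B n)"
    and "homotopy_equivalent R (restrict_scalars_complex (laurent_const R) C) B"
  shows "acyclic_complex (positive_novikov_complex R C) \<and>
         acyclic_complex (negative_novikov_complex R C)"
proof -
  have "acyclic_complex (tensor_complex (laurent_poly R) C (novikov_module \<epsilon> R))" if "\<epsilon> = 1 \<or> \<epsilon> = -1" for \<epsilon>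
    using assms that by (intro acyclic_novikov_complex) auto
  moreover have "positive_novikov R = series_ring R (novikov_series 1 R)"
    by (simp add: positive_novikov_def novikov_series_def)
  moreover have "negative_novikov R = series_ring R (novikov_series (-1) R)"
  proof -
    \<comment> \<open>The two bounds correspond under \<open>k \<mapsto> -k\<close>.\<close>
    have "(\<exists>k. \<forall>i>k. f i = \<zero>\<^bsub>R\<^esub>) \<longleftrightarrow> (\<exists>k. \<forall>i. -1 * i < k \<longrightarrow> f i = \<zero>\<^bsub>R\<^esub>)" for f :: "int \<Rightarrow> 'a"
      by (metis add.inverse_inverse mult_minus1 neg_less_iff_less)
    then show ?thesis
      by (simp add: negative_novikov_def novikov_series_def)
  qed
  ultimately show ?thesis
    by (simp add: positive_novikov_complex_def negative_novikov_complex_def)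
qed

end
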